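(* If $k$ is a positive integer with $k\equiv 3\pmod 4$, then the super domination number can be computed in linear time over the class of $k$-subdivision graphs; that is, there is an algorithm which, given any $k$-subdivision graph $F$, computes $\gamma_{\rm sp}(F)$ in time linear in the size of $F$.
   Context: All graphs are finite, simple and undirected. For an integer $k\ge 1$, the $k$-subdivision $S_k(G)$ of $G$ is the graph obtained from $G$ by replacing each edge with a disjoint path of length $k+1$, that is, by subdividing each edge exactly $k$ times. A graph $F$ is a $k$-subdivision graph if $F$ can be obtained as the $k$-subdivision $S_k(G)$ of some graph $G$. For $D\subseteq V(G)$ write $\overline{D}=V(G)\setminus D$, and let $N_G(v)$ be the open neighborhood of $v$. A set $D\subseteq V(G)$ is a dominating set if every vertex of $\overline{D}$ has a neighbor in $D$. A dominating set $D$ is a super dominating set if for every $x\in\overline{D}$ there exists $y\in D$ such that $N_G(y)\cap\overline{D}=\{x\}$. The super domination number $\gamma_{\rm sp}(G)$ is the minimum cardinality of a super dominating set of $G$. *)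

theory Defs
  imports "Graph_Theory.Graph_Theory" "HOL-Number_Theory.Cong"
begin

text \<open>
  A finite simple undirected graph is a \<open>pair_graph\<close>: an edge \<open>uv\<close> is represented by the two
  arcs \<open>(u, v)\<close> and \<open>(v, u)\<close>.
\<close>

section \<open>Super domination\<close>

definition open_nbhd :: "'a pair_pre_digraph \<Rightarrow> 'a \<Rightarrow> 'a set" where
  "open_nbhd G v = {w. (v, w) \<in> parcs G}"

definition dominating_set :: "'a pair_pre_digraph \<Rightarrow> 'a set \<Rightarrow> bool" where
  "dominating_set G D \<longleftrightarrow>
     D \<subseteq> pverts G \<and> (\<forall>x \<in> pverts G - D. open_nbhd G x \<inter> D \<noteq> {})"

definition super_dominating_set :: "'a pair_pre_digraph \<Rightarrow> 'a set \<Rightarrow> bool" where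
  "super_dominating_set G D \<longleftrightarrow>
     dominating_set G D \<and>
     (\<forall>x \<in> pverts G - D. \<exists>y \<in> D. open_nbhd G y \<inter> (pverts G - D) = {x})"

definition super_domination_number :: "'a pair_pre_digraph \<Rightarrow> nat" where
  "super_domination_number G = Min (card ` {D. super_dominating_set G D})"

section \<open>Subdivisions\<close>

datatype 'a subdiv_vertex = Orig 'a | Inner 'a 'a nat

text \<open>
  \<open>path_vertex k u v i\<close> is the \<open>i\<close>-th vertex (\<open>0 \<le> i \<le> k + 1\<close>) of the path of length \<open>k + 1\<close> that
  replaces the edge \<open>uv\<close>. Each edge is listed once, oriented so that \<open>u < v\<close>.
\<close>

definition path_vertex :: "nat \<Rightarrow> 'a \<Rightarrow> 'a \<Rightarrow> nat \<Rightarrow> 'a subdiv_vertex" where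
  "path_vertex k u v i = (if i = 0 then Orig u else if i = k + 1 then Orig v else Inner u v i)"

definition k_subdivision ::
    "nat \<Rightarrow> 'a::linorder pair_pre_digraph \<Rightarrow> 'a subdiv_vertex pair_pre_digraph" where
  "k_subdivision k G =
     (let path_arcs = {(path_vertex k u v i, path_vertex k u v (i + 1)) | u v i.
                         (u, v) \<in> parcs G \<and> u < v \<and> i \<le> k}
      in \<lparr> pverts = Orig ` pverts G \<union>
                    {Inner u v i | u v i. (u, v) \<in> parcs G \<and> u < v \<and> 1 \<le> i \<and> i \<le> k},
           parcs = path_arcs \<union> path_arcs\<inverse> \<rparr>)"

text \<open>Every finite graph is isomorphic to one on natural numbers, so \<open>G\<close> loses no generality.\<close>

definition k_subdivision_graph :: "nat \<Rightarrow> 'a pair_pre_digraph \<Rightarrow> bool" where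
  "k_subdivision_graph k F \<longleftrightarrow>
     pair_graph F \<and>
     (\<exists>G :: nat pair_pre_digraph. pair_graph G \<and>
        digraph_iso (with_proj (k_subdivision k G)) (with_proj F))"

section \<open>Random access machines\<close>

text \<open>
  A program is a finite list of instructions. The first argument of each instruction is the target
  register (for \<open>Store\<close>, the register holding the target address; for \<open>Jump_Zero\<close>, the register
  tested). Memory is reachable only through addresses held in registers. Subtraction on \<open>nat\<close> is
  truncated at \<open>0\<close>.
\<close>

datatype instr =
    Const nat nat
  | Add nat nat nat
  | Sub nat nat nat
  | Load nat nat
  | Store nat nat
  | Jump_Zero nat nat

record config =
  pc :: nat
  reg :: "nat \<Rightarrow> nat"
  mem :: "nat \<Rightarrow> nat"

definition set_reg :: "nat \<Rightarrow> nat \<Rightarrow> config \<Rightarrow> config" where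
  "set_reg r x c = c\<lparr> pc := pc c + 1, reg := (reg c)(r := x) \<rparr>"

fun exec :: "instr \<Rightarrow> config \<Rightarrow> config" where
  "exec (Const r n) c = set_reg r n c"
| "exec (Add r s t) c = set_reg r (reg c s + reg c t) c"
| "exec (Sub r s t) c = set_reg r (reg c s - reg c t) c"
| "exec (Load r s) c = set_reg r (mem c (reg c s)) c"
| "exec (Store r s) c = c\<lparr> pc := pc c + 1, mem := (mem c)(reg c r := reg c s) \<rparr>"
| "exec (Jump_Zero r l) c = c\<lparr> pc := (if reg c r = 0 then l else pc c + 1) \<rparr>"

definition halted :: "instr list \<Rightarrow> config \<Rightarrow> bool" where
  "halted P c \<longleftrightarrow> length P \<le> pc c"

definition step :: "instr list \<Rightarrow> config \<Rightarrow> config" where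
  "step P c = (if halted P c then c else exec (P ! pc c) c)"

definition init_config :: "nat list \<Rightarrow> config" where
  "init_config xs =
     \<lparr> pc = 0, reg = (\<lambda>_. 0), mem = (\<lambda>a. if a < length xs then xs ! a else 0) \<rparr>"

definition run :: "instr list \<Rightarrow> nat list \<Rightarrow> nat \<Rightarrow> config" where
  "run P xs t = (step P ^^ t) (init_config xs)"

definition words_le :: "nat \<Rightarrow> config \<Rightarrow> bool" where
  "words_le b c \<longleftrightarrow> (\<forall>r. reg c r \<le> b) \<and> (\<forall>a. mem c a \<le> b)"

section \<open>Graphs as inputs, and linear time\<close>

text \<open>
  The vertices are numbered \<open>0, \<dots>, n - 1\<close> arbitrarily (vertex number \<open>i\<close> is \<open>vs ! i\<close>), and
  \<open>adj ! i\<close> lists the numbers of the neighbours of vertex number \<open>i\<close>, in arbitrary order.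
\<close>

definition adjacency_lists :: "'a pair_pre_digraph \<Rightarrow> nat list list \<Rightarrow> bool" where
  "adjacency_lists F adj \<longleftrightarrow>
     (\<exists>vs. distinct vs \<and> set vs = pverts F \<and> length adj = length vs \<and>
        (\<forall>i < length vs. distinct (adj ! i) \<and>
           set (adj ! i) = {j. j < length vs \<and> (vs ! i, vs ! j) \<in> parcs F}))"

text \<open>The input words: \<open>n\<close>, followed for each vertex by its degree and its neighbours.\<close>

definition encode :: "nat list list \<Rightarrow> nat list" where
  "encode adj = length adj # concat (map (\<lambda>ns. length ns # ns) adj)"

text \<open>Number of vertices plus number of edges; every edge contributes two arcs.\<close>

definition graph_size :: "'a pair_pre_digraph \<Rightarrow> nat" where
  "graph_size F = card (pverts F) + card (parcs F) div 2"

text \<open>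
  \<open>f\<close> is computed in linear time on the class \<open>X\<close> if a single program, started on any adjacency list
  representation of any \<open>F\<close> in \<open>X\<close>, halts within \<open>O(graph_size F)\<close> unit-cost steps with \<open>f F\<close> in
  register \<open>0\<close>. As usual for word machines, all words occurring during the computation are required
  to have \<open>O(log (graph_size F))\<close> bits, i.e. to be polynomially bounded; this rules out the abuse of
  unit-cost arithmetic on huge numbers. The summands \<open>1\<close> and \<open>2\<close> below only matter for graphs with
  at most one vertex.
\<close>

definition linear_time_computable ::
    "'a pair_pre_digraph set \<Rightarrow> ('a pair_pre_digraph \<Rightarrow> nat) \<Rightarrow> bool" where
  "linear_time_computable X f \<longleftrightarrow>
     (\<exists>P C. \<forall>F \<in> X. \<forall>adj. adjacency_lists F adj \<longrightarrow>
        (\<exists>t \<le> C * (graph_size F + 1).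
           halted P (run P (encode adj) t) \<and> reg (run P (encode adj) t) 0 = f F) \<and>
        (\<forall>t. words_le ((graph_size F + 2) ^ C) (run P (encode adj) t)))"

end

theory Submission
  imports Defs
begin

text \<open>
  Let \<open>k = 4q + 3\<close> and let \<open>F\<close> be the \<open>k\<close>-subdivision of a graph \<open>G\<close> with \<open>m\<close> edges. The complement \<open>X\<close> of a
  super dominating set is a set whose elements have private neighbours outside \<open>X\<close>; each \<open>x\<close> and its
  private neighbour span an edge on one of the subdivided paths. A path carries at most \<open>2q + 1\<close> such
  edges, or \<open>2q + 2\<close> if one of them uses an end of the path, and every vertex of \<open>G\<close> can serve only one
  path. So the maximum of \<open>|X|\<close> is \<open>m(2q + 1)\<close> plus the maximal number of vertices of \<open>G\<close> to which
  distinct incident edges can be assigned (the rank; it is the number of vertices minus the number of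
  acyclic components). The rank grows by \<open>mk\<close> under subdivision, whence
  \<open>super_domination_number F = |V(F)| + |E(F)| / 2 - rank F\<close>.

  The rank is computed by leaf stripping: deleting the edge at a leaf lowers the rank by one, and a
  graph without leaves has a rank equal to the number of its nonisolated vertices. It suffices to
  store, for every vertex, the number and the sum of its remaining neighbours: the sum at a leaf is
  its only neighbour.
\<close>

section \<open>Ranks and leaves\<close>

text \<open>Why residue 3: for \<open>k = 4q + 3\<close> both the interior of a path
  (\<open>k\<close> vertices) and the whole path (\<open>k + 2\<close>) have odd order, so disjoint
  pairs always miss a vertex; this gives the bounds \<open>2q + 1\<close> and \<open>2q + 2\<close>.
  Conversely, the pattern started at one end puts an \<open>x\<close> on the last inner vertex. That
  vertex has its private neighbour further inside and serves nobody itself, so the status of the far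
  end does not matter and the paths can be filled independently.

  Why a formula in terms of \<open>F\<close>: an original vertex of degree 2 looks locally like a
  subdividing vertex, so the program does not try to recover \<open>G\<close>. As
  \<open>|E(F)| = m(4q + 4)\<close> and \<open>rank F = m(4q + 3) + rank G\<close>, the maximum
  \<open>m(2q + 1) + rank G\<close> equals \<open>rank F - |E(F)| / 2\<close>, where
  \<open>G\<close> no longer occurs.

  Why acyclic components count: around a cycle every vertex can take the next edge, and all others
  the edge towards the cycle; a tree has one edge too few.\<close>

definition orients :: "('a \<times> 'a) set \<Rightarrow> 'a set \<Rightarrow> ('a \<Rightarrow> 'a) \<Rightarrow> bool" where
  "orients A S g \<longleftrightarrow> (\<forall>u\<in>S. (u, g u) \<in> A \<and> (g u \<in> S \<longrightarrow> g (g u) \<noteq> u))"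

text \<open>The vertex \<open>u\<close> takes the edge joining it to \<open>g u\<close>. Only
  \<open>g u\<close> could take the same edge, so for symmetric irreflexive \<open>A\<close> the
  second clause of \<open>orients\<close> makes the edges taken distinct: the orientable sets are
  the independent sets of the transversal matroid of vertex-edge incidence.\<close>

definition orientable :: "('a \<times> 'a) set \<Rightarrow> 'a set \<Rightarrow> bool" where
  "orientable A S \<longleftrightarrow> (\<exists>g. orients A S g)"

definition orient_rank :: "('a \<times> 'a) set \<Rightarrow> nat" where
  "orient_rank A = Max (card ` {S. orientable A S})"

lemma orientable_Domain: "orientable A S \<Longrightarrow> S \<subseteq> Domain A"
  by (auto simp: orientable_def orients_def)

lemma finite_orientable: "finite A \<Longrightarrow> finite {S. orientable A S}"
  by (rule finite_subset[of _ "Pow (Domain A)"]) (auto dest: orientable_Domain simp: finite_Domain)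

lemma card_le_orient_rank: "finite A \<Longrightarrow> orientable A S \<Longrightarrow> card S \<le> orient_rank A"
  unfolding orient_rank_def by (rule Max_ge) (auto simp: finite_orientable)

lemma orient_rank_attained:
  assumes "finite A"
  obtains S where "orientable A S" "card S = orient_rank A"
proof -
  have "orientable A {}" by (simp add: orientable_def orients_def)
  then have "orient_rank A \<in> card ` {S. orientable A S}"
    unfolding orient_rank_def by (intro Max_in) (auto simp: finite_orientable assms)
  then show thesis using that by auto
qed

lemma orientable_image:
  assumes "orientable A S" and inj: "inj_on f (Field A)"
  shows "orientable (map_prod f f ` A) (f ` S)"
proof -
  obtain g where g: "orients A S g" using assms by (auto simp: orientable_def)
  have S: "S \<subseteq> Field A" and gS: "g ` S \<subseteq> Field A"
    using g by (auto simp: orients_def Field_def)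
  define h where "h = f \<circ> g \<circ> the_inv_into (Field A) f"
  have h: "h (f u) = f (g u)" if "u \<in> Field A" for u
    using that by (simp add: h_def the_inv_into_f_f inj)
  have "orients (map_prod f f ` A) (f ` S) h"
    unfolding orients_def
  proof (intro ballI conjI impI, goal_cases)
    case (1 x)
    then obtain u where u: "u \<in> S" "x = f u" by auto
    then have "(f u, f (g u)) \<in> map_prod f f ` A"
      using g by (auto simp: orients_def)
    moreover have "h (f u) = f (g u)" using u S h by auto
    ultimately show ?case using u by simp
  next
    case (2 x)
    then obtain u where u: "u \<in> S" "x = f u" by auto
    have gu: "g u \<in> Field A" using u gS by auto
    have "f (g u) \<in> f ` S" using 2 u S h by auto
    then have "g u \<in> S" using gu S inj by (auto dest: inj_onD)
    then have "g (g u) \<noteq> u" "g (g u) \<in> Field A" using g u gS by (auto simp: orients_def)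
    moreover have "h x = f (g u)" "h (f (g u)) = f (g (g u))" "u \<in> Field A"
      using u S h gu by auto
    ultimately show ?case using u inj by (auto dest: inj_onD)
  qed
  then show ?thesis by (auto simp: orientable_def)
qed

lemma orient_rank_image:
  assumes "finite A" and inj: "inj_on f (Field A)"
  shows "orient_rank (map_prod f f ` A) = orient_rank A"
proof (rule antisym)
  \<comment> \<open>Stated for arbitrary \<open>B\<close> and \<open>h\<close>, so that it serves
    both \<open>f\<close> and the inverse of \<open>f\<close> on the image.\<close>
  have *: "orient_rank B \<le> orient_rank (map_prod h h ` B)"
    if B: "finite B" "inj_on h (Field B)" for B :: "('c \<times> 'c) set" and h :: "'c \<Rightarrow> 'd"
  proof -
    obtain S where S: "orientable B S" "card S = orient_rank B"
      using orient_rank_attained[OF B(1)] .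
    have "S \<subseteq> Field B" using orientable_Domain[OF S(1)] by (auto simp: Field_def)
    then have "card (h ` S) = card S" by (meson card_image inj_on_subset B(2))
    then show ?thesis
      using card_le_orient_rank[OF _ orientable_image[OF S(1) B(2)]] S B by simp
  qed
  show "orient_rank A \<le> orient_rank (map_prod f f ` A)" using * assms by blast
  have FI: "Field (map_prod f f ` A) = f ` Field A" by (auto simp: Field_def Domain_fst Range_snd image_image image_Un)
  let ?h = "the_inv_into (Field A) f"
  have "map_prod ?h ?h ` map_prod f f ` A = id ` A"
    unfolding image_image
  proof (rule image_cong, goal_cases)
    case (2 x)
    then have "fst x \<in> Field A" "snd x \<in> Field A"
      by (cases x, auto simp: Field_def)+
    then show ?case by (cases x) (auto simp: the_inv_into_f_f inj)
  qed simp
  moreover have "inj_on ?h (Field (map_prod f f ` A))"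
    unfolding FI using inj by (rule inj_on_the_inv_into)
  ultimately show "orient_rank (map_prod f f ` A) \<le> orient_rank A"
    using *[of "map_prod f f ` A" ?h] assms(1) by simp
qed

text \<open>At most one vertex of an optimal set takes the edge at the leaf: \<open>u\<close> if it
  is chosen, otherwise at most \<open>w\<close>. Dropping that vertex leaves a set that is
  orientable without the edge. Conversely \<open>u\<close> is isolated after the deletion, so it can
  be added with the deleted edge.\<close>

lemma orient_rank_leaf:
  assumes "finite A" "sym A" "irrefl A" and leaf: "A `` {u} = {w}"
  shows "orient_rank A = Suc (orient_rank (A - {(u, w), (w, u)}))"
proof (rule antisym)
  let ?B = "A - {(u, w), (w, u)}"
  have uw: "u \<noteq> w" "(u, w) \<in> A" "(w, u) \<in> A"
    using leaf assms(2,3) by (auto simp: irrefl_def sym_def)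
  have only: "x = w" if "(u, x) \<in> A \<or> (x, u) \<in> A" for x
    using that leaf assms(2) by (auto simp: sym_def)
  obtain S where S: "orientable A S" "card S = orient_rank A"
    using orient_rank_attained[OF assms(1)] .
  then obtain g where g: "orients A S g" by (auto simp: orientable_def)
  define T where "T = S - {if u \<in> S then u else w}"
  have "orients ?B T g"
    using g only uw unfolding orients_def T_def by (auto split: if_splits)
  then have "card T \<le> orient_rank ?B"
    using assms(1) by (intro card_le_orient_rank) (auto simp: orientable_def)
  moreover have "finite S" using orientable_Domain[OF S(1)] assms(1) finite_Domain finite_subset by blast
  then have "card S \<le> Suc (card T)" unfolding T_def by (simp add: card_Diff_singleton_if) arith
  ultimately show "orient_rank A \<le> Suc (orient_rank ?B)" using S by simp
  obtain S where S: "orientable ?B S" "card S = orient_rank ?B"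
    using orient_rank_attained assms(1) by blast
  then obtain g where g: "orients ?B S g" by (auto simp: orientable_def)
  have uS: "u \<notin> S" using g only unfolding orients_def by blast
  have "orients A (insert u S) (g(u := w))"
    using g only uw uS unfolding orients_def by auto
  then have "card (insert u S) \<le> orient_rank A"
    using assms(1) by (intro card_le_orient_rank) (auto simp: orientable_def)
  moreover have "finite S" using orientable_Domain[OF S(1)] assms(1)
    by (meson finite_Diff finite_Domain finite_subset)
  ultimately show "Suc (orient_rank ?B) \<le> orient_rank A" using S uS by simp
qed

text \<open>The shortest return of a non-backtracking walk is a cycle, of length at least \<open>3\<close>.\<close>

lemma exists_cycle:
  assumes fin: "finite A" and "irrefl A" and "A \<noteq> {}" and sym: "sym A"
    and deg: "\<And>u. card (A `` {u}) \<noteq> 1"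
  obtains C g where "C \<noteq> {}" "g ` C \<subseteq> C" "orients A C g"
proof -
  have next_ex: "\<exists>w. (v, w) \<in> A \<and> w \<noteq> u" if "(u, v) \<in> A" for u v
  proof (rule ccontr)
    assume "\<not> ?thesis"
    then have "A `` {v} = {u}" using that sym by (auto simp: sym_def)
    then show False using deg[of v] by simp
  qed
  obtain a where "a \<in> A" using \<open>A \<noteq> {}\<close> by blast
  \<comment> \<open>The choice is made on arcs rather than on vertices: not turning back is then a
    relation between consecutive choices.\<close>
  have "\<exists>f. \<forall>n::nat. f n \<in> A \<and> (fst (f (Suc n)) = snd (f n) \<and> snd (f (Suc n)) \<noteq> fst (f n))"
  proof (rule dependent_nat_choice)
    show "\<exists>x. x \<in> A" using \<open>a \<in> A\<close> by blast
    show "\<exists>y. y \<in> A \<and> fst y = snd x \<and> snd y \<noteq> fst x" if "x \<in> A" for x n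
      using next_ex[of "fst x" "snd x"] that by auto
  qed
  then obtain f where f: "\<And>n. f n \<in> A" "\<And>n. fst (f (Suc n)) = snd (f n)"
    "\<And>n. snd (f (Suc n)) \<noteq> fst (f n)" by blast
  define p where "p n = fst (f n)" for n
  have p: "(p n, p (Suc n)) \<in> A" "p (Suc (Suc n)) \<noteq> p n" for n
    using f(1)[of n] f(2)[of n] f(3)[of n] f(2)[of "Suc n"] by (simp_all add: p_def)
  have "range p \<subseteq> Domain A" using p by auto
  then have "finite (range p)" using fin finite_Domain finite_subset by blast
  then have "\<not> inj p" using finite_imageD infinite_UNIV_nat by blast
  then obtain i j where "i < j" "p j = p i" unfolding inj_def by (metis linorder_neqE_nat)
  \<comment> \<open>\<open>Q e\<close> says that the walk somewhere returns after \<open>e\<close>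
    steps. For the least such \<open>d\<close>, no vertex repeats among \<open>d\<close> consecutive
    ones.\<close>
  define Q where "Q e \<longleftrightarrow> 0 < e \<and> (\<exists>i. p (i + e) = p i)" for e
  have "Q (j - i)" using \<open>i < j\<close> \<open>p j = p i\<close> unfolding Q_def by (auto intro!: exI[of _ i])
  then obtain d where d: "Q d" and dmin: "\<And>e. e < d \<Longrightarrow> \<not> Q e"
    using exists_least_iff[of Q] by blast
  from d obtain i where i: "0 < d" "p (i + d) = p i" unfolding Q_def by blast
  \<comment> \<open>No return after one step, as there are no loops, and none after two, as the walk
    never turns back. Length at least 3 is what keeps \<open>g (g x)\<close> apart from
    \<open>x\<close> on the cycle.\<close>
  have "p (Suc n) \<noteq> p n" for n using p(1)[of n] \<open>irrefl A\<close> unfolding irrefl_def by auto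
  then have "p (i + 1) \<noteq> p i" by simp
  moreover have "p (i + 2) \<noteq> p i" using p(2)[of i] by simp
  ultimately have "d \<noteq> 1" "d \<noteq> 2" using i(2) by metis+
  then have d3: "3 \<le> d" using i(1) by linarith
  have inj: "inj_on p {i..<i + d}"
  proof (rule inj_onI)
    have *: False if "x < y" "x \<in> {i..<i + d}" "y \<in> {i..<i + d}" "p x = p y" for x y
    proof -
      have "y - x < d" "0 < y - x" using that(1-3) unfolding atLeastLessThan_iff by linarith+
      moreover have "p (x + (y - x)) = p x" using that(1,4) by simp
      ultimately show False using dmin[of "y - x"] unfolding Q_def by blast
    qed
    show "x = y" if "x \<in> {i..<i + d}" "y \<in> {i..<i + d}" "p x = p y" for x y
      using *[of x y] *[of y x] that by (metis linorder_neqE_nat)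
  qed
  define C where "C = p ` {i..<i + d}"
  define g where "g = (\<lambda>x. p (Suc (the_inv_into {i..<i + d} p x)))"
  \<comment> \<open>The successor in terms of indices: the step from the last index leads to
    \<open>p (i + d) = p i\<close>, so it wraps around to \<open>i\<close>.\<close>
  define s where "s j = (if Suc j = i + d then i else Suc j)" for j
  have g: "g (p j) = p (s j)" "s j \<in> {i..<i + d}" if "j \<in> {i..<i + d}" for j
    using that i by (auto simp: g_def s_def the_inv_into_f_f[OF inj])
  have ss: "s (s j) \<noteq> j" if "j \<in> {i..<i + d}" for j
    using that d3 by (auto simp: s_def)
  show thesis
  proof
    show "C \<noteq> {}" using i by (auto simp: C_def)
    show "g ` C \<subseteq> C" using g by (auto simp: C_def)
    show "orients A C g"
      unfolding orients_def C_def
    proof (intro ballI conjI impI, goal_cases)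
      case (1 x)
      then show ?case using p(1) by (auto simp: g_def the_inv_into_f_f[OF inj])
    next
      case (2 x)
      then obtain j where j: "j \<in> {i..<i + d}" "x = p j" by auto
      then have "g x = p (s j)" "g (g x) = p (s (s j))" "s j \<in> {i..<i + d}" "s (s j) \<in> {i..<i + d}"
        using g by auto
      then show ?case using j ss inj_onD[OF inj] by metis
    qed
  qed
qed

text \<open>Consider a maximal set that is orientable with all targets inside. A vertex adjacent to
  it could be pointed into it, and a part of the graph away from it has no leaf either, hence
  contains a cycle that could be added. So the set contains every nonisolated vertex.\<close>

lemma orient_rank_no_leaf:
  assumes fin: "finite A" and sym: "sym A" and irr: "irrefl A"
    and deg: "\<And>u. card (A `` {u}) \<noteq> 1"
  shows "orient_rank A = card (Domain A)"
proof -
  \<comment> \<open>Targets must stay in \<open>S\<close> so that a vertex added later is never the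
    target of an old one; its edge is then free.\<close>
  let ?P = "\<lambda>S. \<exists>g. orients A S g \<and> g ` S \<subseteq> S"
  have "finite {S. ?P S}" (is "finite ?F")
    by (rule finite_subset[OF _ finite_orientable[OF fin]]) (auto simp: orientable_def)
  moreover have "{} \<in> ?F" by (auto simp: orients_def)
  then have "?F \<noteq> {}" by blast
  ultimately have "\<exists>S\<in>?F. \<forall>T\<in>?F. S \<subseteq> T \<longrightarrow> S = T"
    by (rule finite_has_maximal)
  then obtain S where S: "S \<in> ?F" and S_max: "\<forall>T\<in>?F. S \<subseteq> T \<longrightarrow> S = T"
    by (rule bexE)
  have max: "T = S" if "orients A T h \<and> h ` T \<subseteq> T" "S \<subseteq> T" for T h
  proof -
    have "T \<in> ?F" using that(1) by blast
    then show ?thesis using S_max that(2) by (metis (lifting))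
  qed
  obtain g where g: "orients A S g" "g ` S \<subseteq> S" using S by blast
  have closed: "v \<in> S" if "w \<in> S" "(v, w) \<in> A" for v w
  proof (rule ccontr)
    assume v: "v \<notin> S"
    have "orients A (insert v S) (g(v := w)) \<and> (g(v := w)) ` insert v S \<subseteq> insert v S"
      using g that v irr unfolding orients_def irrefl_def by auto
    then have "insert v S = S" by (rule max) blast
    then show False using v by blast
  qed
  define B where "B = A \<inter> ((- S) \<times> (- S))"
  have "B = {}"
  proof (rule ccontr)
    assume ne: "B \<noteq> {}"
    \<comment> \<open>By \<open>closed\<close>, no arc joins \<open>S\<close> to its complement, so
      degrees in the complement are unchanged by the restriction.\<close>
    have "B `` {u} = (if u \<in> S then {} else A `` {u})" for u
      using closed sym by (auto simp: B_def sym_def)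
    then have degB: "card (B `` {u}) \<noteq> 1" for u using deg by simp
    have "finite B" "irrefl B" "sym B"
      using fin irr sym by (auto simp: B_def irrefl_def sym_def)
    then obtain C h where C: "C \<noteq> {}" "h ` C \<subseteq> C" "orients B C h"
      using exists_cycle[of B] ne degB by metis
    have CS: "C \<inter> S = {}" using C(3) by (auto simp: orients_def B_def)
    let ?k = "\<lambda>x. if x \<in> C then h x else g x"
    have "orients A (C \<union> S) ?k \<and> ?k ` (C \<union> S) \<subseteq> C \<union> S"
      using C g CS unfolding orients_def B_def by auto
    then have "C \<union> S = S" by (rule max) blast
    then show False using C CS by blast
  qed
  have "Domain A \<subseteq> S"
  proof
    fix v assume "v \<in> Domain A"
    then obtain w where "(v, w) \<in> A" by auto
    then show "v \<in> S" using \<open>B = {}\<close> closed by (auto simp: B_def)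
  qed
  moreover have "orientable A S" using g by (auto simp: orientable_def)
  ultimately have S: "S = Domain A" using orientable_Domain by blast
  obtain T where "orientable A T" "card T = orient_rank A"
    using orient_rank_attained[OF fin] .
  then have "orient_rank A \<le> card (Domain A)"
    using orientable_Domain card_mono finite_Domain[OF fin] by metis
  then show ?thesis
    using card_le_orient_rank[OF fin \<open>orientable A S\<close>] S by simp
qed

section \<open>Super domination in subdivisions\<close>

definition private_set :: "'a pair_pre_digraph \<Rightarrow> 'a set \<Rightarrow> bool" where
  "private_set G X \<longleftrightarrow>
     X \<subseteq> pverts G \<and> (\<forall>x\<in>X. \<exists>y\<in>pverts G - X. open_nbhd G y \<inter> X = {x})"

text \<open>By symmetry the private neighbour of \<open>x\<close> is a neighbour of \<open>x\<close>
  in \<open>D\<close>, so private neighbours already yield domination.\<close>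

lemma super_dominating_iff_private:
  assumes "sym (parcs G)"
  shows "super_dominating_set G D \<longleftrightarrow> D \<subseteq> pverts G \<and> private_set G (pverts G - D)"
proof
  assume "super_dominating_set G D"
  moreover from this have "pverts G - (pverts G - D) = D"
    by (auto simp: super_dominating_set_def dominating_set_def)
  ultimately show "D \<subseteq> pverts G \<and> private_set G (pverts G - D)"
    unfolding super_dominating_set_def dominating_set_def private_set_def by auto
next
  assume D: "D \<subseteq> pverts G \<and> private_set G (pverts G - D)"
  then have y: "\<exists>y\<in>D. open_nbhd G y \<inter> (pverts G - D) = {x}" if "x \<in> pverts G - D" for x
    using that unfolding private_set_def by (metis double_diff subset_refl)
  have "open_nbhd G x \<inter> D \<noteq> {}" if "x \<in> pverts G - D" for x
  proof -
    obtain y where "y \<in> D" "x \<in> open_nbhd G y" using y[OF \<open>x \<in> pverts G - D\<close>] by blast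
    then have "y \<in> open_nbhd G x" using assms by (auto simp: open_nbhd_def sym_def)
    then show ?thesis using \<open>y \<in> D\<close> by blast
  qed
  then show "super_dominating_set G D"
    using y D unfolding super_dominating_set_def dominating_set_def by blast
qed

lemma super_domination_number_eqI:
  assumes fin: "finite (pverts G)" and sym: "sym (parcs G)"
    and X: "private_set G X" and max: "\<And>Y. private_set G Y \<Longrightarrow> card Y \<le> card X"
  shows "super_domination_number G = card (pverts G) - card X"
  unfolding super_domination_number_def
proof (rule Min_eqI)
  have "finite {D. super_dominating_set G D}"
    using fin by (rule finite_subset[rotated, of "Pow (pverts G)", simplified])
      (auto simp: super_dominating_set_def dominating_set_def)
  then show "finite (card ` {D. super_dominating_set G D})" by simp
next
  fix n assume "n \<in> card ` {D. super_dominating_set G D}"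
  then obtain D where D: "super_dominating_set G D" "n = card D" by blast
  then have "D \<subseteq> pverts G" "private_set G (pverts G - D)"
    using super_dominating_iff_private[OF sym] by blast+
  then have "card (pverts G) - card D \<le> card X" using max fin finite_subset
    by (metis card_Diff_subset)
  then show "card (pverts G) - card X \<le> n" using D by simp
next
  have XV: "X \<subseteq> pverts G" using X by (auto simp: private_set_def)
  then have "super_dominating_set G (pverts G - X)"
    using X super_dominating_iff_private[OF sym] by (simp add: double_diff)
  moreover have "card (pverts G - X) = card (pverts G) - card X"
    using XV fin finite_subset card_Diff_subset by blast
  ultimately show "card (pverts G) - card X \<in> card ` {D. super_dominating_set G D}"
    by (metis imageI mem_Collect_eq)
qed

lemma super_domination_number_image_le:
  assumes fin: "finite (pverts G)" and inj: "inj_on h (pverts G)"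
    and arcs: "parcs G \<subseteq> pverts G \<times> pverts G"
    and H: "pverts H = h ` pverts G" "parcs H = map_prod h h ` parcs G"
  shows "super_domination_number H \<le> super_domination_number G"
proof -
  have nb: "open_nbhd H (h v) = h ` open_nbhd G v" if "v \<in> pverts G" for v
    using inj_onD[OF inj _ that] arcs that unfolding open_nbhd_def H by force
  have nbV: "open_nbhd G v \<subseteq> pverts G" for v using arcs by (auto simp: open_nbhd_def)
  have *: "super_dominating_set H (h ` D)" if D: "super_dominating_set G D" for D
  proof -
    have DV: "D \<subseteq> pverts G" using D by (auto simp: super_dominating_set_def dominating_set_def)
    have diff: "pverts H - h ` D = h ` (pverts G - D)"
      unfolding H using inj_on_image_set_diff[OF inj, of "pverts G" D] DV by auto
    have int: "h ` A \<inter> h ` B = h ` (A \<inter> B)" if "A \<subseteq> pverts G" "B \<subseteq> pverts G" for A B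
      using inj_on_image_Int[OF inj that] by simp
    show ?thesis
      unfolding super_dominating_set_def dominating_set_def diff
    proof (intro conjI ballI)
      show "h ` D \<subseteq> pverts H" using DV H by auto
    next
      fix x assume "x \<in> h ` (pverts G - D)"
      then obtain u where u: "u \<in> pverts G - D" "x = h u" by blast
      then have "open_nbhd G u \<inter> D \<noteq> {}"
        using D by (auto simp: super_dominating_set_def dominating_set_def)
      then show "open_nbhd H x \<inter> h ` D \<noteq> {}" using u nb by auto
    next
      fix x assume "x \<in> h ` (pverts G - D)"
      then obtain u where u: "u \<in> pverts G - D" "x = h u" by blast
      then obtain y where y: "y \<in> D" "open_nbhd G y \<inter> (pverts G - D) = {u}"
        using D unfolding super_dominating_set_def by blast
      moreover have "open_nbhd H (h y) = h ` open_nbhd G y" using DV y nb by blast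
      ultimately have "open_nbhd H (h y) \<inter> h ` (pverts G - D) = h ` {u}"
        using int[OF nbV, of "pverts G - D" y] by simp
      then show "\<exists>y\<in>h ` D. open_nbhd H y \<inter> h ` (pverts G - D) = {x}"
        using y u by auto
    qed
  qed
  have fins: "finite {D. super_dominating_set K D}" if "finite (pverts K)" for K :: "'c pair_pre_digraph"
    by (rule finite_subset[of _ "Pow (pverts K)"])
      (use that in \<open>auto simp: super_dominating_set_def dominating_set_def\<close>)
  have "super_dominating_set G (pverts G)"
    by (auto simp: super_dominating_set_def dominating_set_def)
  then have "super_domination_number G \<in> card ` {D. super_dominating_set G D}"
    unfolding super_domination_number_def by (intro Min_in) (use fins[OF fin] in auto)
  then obtain D where D: "super_dominating_set G D" "super_domination_number G = card D" by blast
  then have "D \<subseteq> pverts G" by (auto simp: super_dominating_set_def dominating_set_def)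
  then have "card (h ` D) = card D" using inj card_image inj_on_subset by blast
  moreover have "super_domination_number H \<le> card (h ` D)"
    unfolding super_domination_number_def
    by (rule Min_le) (use *[OF D(1)] fins[of H] fin H in auto)
  ultimately show ?thesis using D by simp
qed

lemma super_domination_number_image:
  assumes fin: "finite (pverts G)" and inj: "inj_on h (pverts G)"
    and arcs: "parcs G \<subseteq> pverts G \<times> pverts G"
    and H: "pverts H = h ` pverts G" "parcs H = map_prod h h ` parcs G"
  shows "super_domination_number H = super_domination_number G"
proof (rule antisym)
  show "super_domination_number H \<le> super_domination_number G"
    using assms by (rule super_domination_number_image_le)
  let ?h = "the_inv_into (pverts G) h"
  have "pverts G = ?h ` pverts H" unfolding H using inj by simp
  moreover have "parcs G = map_prod ?h ?h ` parcs H"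
  proof -
    have "map_prod ?h ?h (map_prod h h x) = x" if "x \<in> parcs G" for x
      using that arcs by (cases x) (auto simp: the_inv_into_f_f inj)
    then show ?thesis unfolding H image_image by simp
  qed
  moreover have "inj_on ?h (pverts H)" unfolding H using inj by (rule inj_on_the_inv_into)
  moreover have "parcs H \<subseteq> pverts H \<times> pverts H" using arcs unfolding H by auto
  ultimately show "super_domination_number G \<le> super_domination_number H"
    using fin H by (intro super_domination_number_image_le) auto
qed

section \<open>A subdivision as a family of paths\<close>

locale subdivided_graph = pair_graph G for G :: "'a::linorder pair_pre_digraph" +
  fixes k :: nat
  assumes k_pos: "0 < k"
begin

abbreviation "F \<equiv> k_subdivision k G"

definition "E = {e \<in> parcs G. fst e < snd e}"

definition "P e i = path_vertex k (fst e) (snd e) i"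

lemma P_0 [simp]: "P e 0 = Orig (fst e)"
  and P_last [simp]: "P e (Suc k) = Orig (snd e)"
  and P_inner: "1 \<le> i \<Longrightarrow> i \<le> k \<Longrightarrow> P e i = Inner (fst e) (snd e) i"
  by (auto simp: P_def path_vertex_def)

lemma P_cases:
  assumes "i \<le> Suc k"
  obtains "i = 0" "P e i = Orig (fst e)" | "i = Suc k" "P e i = Orig (snd e)"
  | "1 \<le> i" "i \<le> k" "P e i = Inner (fst e) (snd e) i"
  using assms P_inner[of i e] by (cases "i = 0"; cases "i = Suc k") auto

lemma finite_E: "finite E"
  by (auto simp: E_def)

lemma ends_E: "e \<in> E \<Longrightarrow> fst e \<in> pverts G \<and> snd e \<in> pverts G \<and> fst e < snd e"
  by (auto simp: E_def)

lemma sym_parcs: "sym (parcs G)"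
  using pair_sym_arcs by (simp add: symmetric_def)

lemma arc_E: "(u, v) \<in> parcs G \<Longrightarrow> (u, v) \<in> E \<or> (v, u) \<in> E"
  using sym_parcs pair_no_loops[of "(u, v)"] by (auto simp: E_def sym_def)

lemma P_inj: "e \<in> E \<Longrightarrow> i \<le> Suc k \<Longrightarrow> j \<le> Suc k \<Longrightarrow> P e i = P e j \<Longrightarrow> i = j"
  using ends_E[of e] by (elim P_cases[of i e] P_cases[of j e]) auto

lemma inj_on_P: "e \<in> E \<Longrightarrow> I \<subseteq> {..Suc k} \<Longrightarrow> inj_on (P e) I"
  by (rule inj_onI) (auto intro: P_inj)

lemma P_inner_eq:
  assumes "1 \<le> i" "i \<le> k" "j \<le> Suc k" "P e i = P e' j \<or> P e' j = P e i"
  shows "e = e' \<and> i = j"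
  using assms P_inner[of i e] by (elim P_cases[of j e']) (auto simp: prod_eq_iff)

lemma P_inner_neq_Orig: "1 \<le> i \<Longrightarrow> i \<le> k \<Longrightarrow> P e i \<noteq> Orig x"
  by (simp add: P_inner)

lemma verts_F: "pverts F = Orig ` pverts G \<union> (\<Union>e\<in>E. P e ` {1..k})"
proof -
  have "{Inner u v i | u v i. (u, v) \<in> parcs G \<and> u < v \<and> 1 \<le> i \<and> i \<le> k}
    = (\<Union>e\<in>E. P e ` {1..k})"
    (is "?L = ?R")
  proof -
    have "P e ` {1..k} = Inner (fst e) (snd e) ` {1..k}" for e
      by (rule image_cong) (auto simp: P_inner)
    then have "?R = (\<Union>e\<in>E. Inner (fst e) (snd e) ` {1..k})" by (intro SUP_cong refl)
    also have "\<dots> = ?L" by (auto simp: E_def)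
    finally show ?thesis by simp
  qed
  then show ?thesis by (simp add: k_subdivision_def Let_def)
qed

lemma arcs_F: "(a, b) \<in> parcs F \<longleftrightarrow>
  (\<exists>e\<in>E. \<exists>i\<le>k. a = P e i \<and> b = P e (Suc i) \<or> b = P e i \<and> a = P e (Suc i))"
proof -
  have "{(path_vertex k u v i, path_vertex k u v (i + 1)) | u v i. (u, v) \<in> parcs G \<and> u < v \<and> i \<le> k}
    = {(P e i, P e (Suc i)) | e i. e \<in> E \<and> i \<le> k}"
    by (auto simp: E_def P_def)
  then show ?thesis
    unfolding k_subdivision_def Let_def by auto
qed

lemma arcs_F_cases:
  assumes "(a, b) \<in> parcs F"
  obtains e i j where "e \<in> E" "i \<le> Suc k" "j \<le> Suc k" "j = Suc i \<or> i = Suc j"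
    "a = P e i" "b = P e j"
proof -
  obtain e i where "e \<in> E" "i \<le> k" "a = P e i \<and> b = P e (Suc i) \<or> b = P e i \<and> a = P e (Suc i)"
    using assms unfolding arcs_F by blast
  then show thesis using that[of e i "Suc i"] that[of e "Suc i" i] by auto
qed

lemma P_arc: "e \<in> E \<Longrightarrow> i \<le> Suc k \<Longrightarrow> j \<le> Suc k \<Longrightarrow> j = Suc i \<or> i = Suc j \<Longrightarrow> (P e i, P e j) \<in> parcs F"
  unfolding arcs_F by (rule bexI[of _ e], rule exI[of _ "min i j"]) auto

lemma sym_F: "sym (parcs F)"
  by (rule symI) (auto simp: arcs_F)

lemma P_in_F: "e \<in> E \<Longrightarrow> i \<le> Suc k \<Longrightarrow> P e i \<in> pverts F"
proof (cases "1 \<le> i \<and> i \<le> k")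
  case True
  then have "P e i \<in> P e ` {1..k}" by simp
  then show "e \<in> E \<Longrightarrow> P e i \<in> pverts F" unfolding verts_F by blast
next
  case False
  then show "e \<in> E \<Longrightarrow> i \<le> Suc k \<Longrightarrow> P e i \<in> pverts F"
    unfolding verts_F using ends_E[of e] by (elim P_cases[of i e]) auto
qed

lemma parcs_F_subset: "parcs F \<subseteq> pverts F \<times> pverts F"
proof
  fix x assume "x \<in> parcs F"
  then obtain a b where "x = (a, b)" "(a, b) \<in> parcs F" by (cases x) auto
  then show "x \<in> pverts F \<times> pverts F" using P_in_F by (elim arcs_F_cases) auto
qed

lemma finite_verts_F: "finite (pverts F)"
  unfolding verts_F by (auto simp: finite_E)

lemma finite_arcs_F: "finite (parcs F)"
  by (rule finite_subset[OF parcs_F_subset]) (simp add: finite_verts_F)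

lemma open_nbhd_inner:
  assumes "e \<in> E" "1 \<le> i" "i \<le> k"
  shows "open_nbhd F (P e i) = {P e (i - 1), P e (Suc i)}"
proof (rule set_eqI)
  fix b
  have "(P e i, b) \<in> parcs F \<longleftrightarrow> b = P e (i - 1) \<or> b = P e (Suc i)" (is "?L = ?R")
  proof
    assume ?L
    then show ?R
    proof (cases rule: arcs_F_cases)
      case (1 e' i' j)
      then have "e = e' \<and> i = i'" using P_inner_eq assms by blast
      then show ?thesis using 1 by auto
    qed
  next
    assume ?R
    then show ?L using assms by (auto intro!: P_arc)
  qed
  then show "b \<in> open_nbhd F (P e i) \<longleftrightarrow> b \<in> {P e (i - 1), P e (Suc i)}"
    by (simp add: open_nbhd_def)
qed

text \<open>Counts the two sets that are built from an orientable \<open>S\<close> for the lower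
  bounds: interiors of different paths are disjoint from each other and from the original
  vertices.\<close>

lemma card_union_inner:
  assumes "S \<subseteq> pverts G" and I: "\<And>e. e \<in> E \<Longrightarrow> I e \<subseteq> {1..k}" "\<And>e. e \<in> E \<Longrightarrow> card (I e) = c"
  shows "card (Orig ` S \<union> (\<Union>e\<in>E. P e ` I e)) = card S + c * card E"
proof -
  have finS: "finite S" using assms(1) pair_finite_verts by (rule finite_subset)
  have finI: "finite (P e ` I e)" if "e \<in> E" for e using I(1)[OF that] finite_subset by blast
  have "card (\<Union>e\<in>E. P e ` I e) = (\<Sum>e\<in>E. card (P e ` I e))"
  proof (rule card_UN_disjoint)
    show "\<forall>e\<in>E. \<forall>e'\<in>E. e \<noteq> e' \<longrightarrow> P e ` I e \<inter> P e' ` I e' = {}"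
    proof (intro ballI impI)
      fix e e' assume *: "e \<in> E" "e' \<in> E" "e \<noteq> e'"
      have "P e i \<noteq> P e' j" if "i \<in> I e" "j \<in> I e'" for i j
        using P_inner_eq[of i j e e'] I(1)[OF *(1)] I(1)[OF *(2)] that * by force
      then show "P e ` I e \<inter> P e' ` I e' = {}" by blast
    qed
  qed (use finite_E finI in auto)
  also have "\<dots> = (\<Sum>e\<in>E. c)"
  proof (rule sum.cong)
    fix e assume "e \<in> E"
    moreover have "inj_on (P e) (I e)" using \<open>e \<in> E\<close> I(1)[of e] by (intro inj_on_P) auto
    ultimately show "card (P e ` I e) = c" using I(2) by (simp add: card_image)
  qed simp
  finally have "card (\<Union>e\<in>E. P e ` I e) = c * card E" by simp
  moreover have "Orig ` S \<inter> (\<Union>e\<in>E. P e ` I e) = {}"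
  proof -
    have "Orig x \<noteq> P e i" if "e \<in> E" "i \<in> I e" for x e i
      using I(1)[OF that(1)] that(2) P_inner_neq_Orig[of i e x] by force
    then show ?thesis by blast
  qed
  moreover have "finite (\<Union>e\<in>E. P e ` I e)" using finite_E finI by blast
  moreover have "card (Orig ` S) = card S" by (rule card_image) (simp add: inj_on_def)
  ultimately show ?thesis using finS by (simp add: card_Un_disjoint)
qed

lemma card_arcs_F: "card (parcs F) = 2 * (Suc k * card E)"
proof -
  let ?I = "E \<times> {..k}" and ?f = "\<lambda>(e, i). (P e i, P e (Suc i))" and ?g = "\<lambda>(e, i). (P e (Suc i), P e i)"
  have parcs: "parcs F = ?f ` ?I \<union> ?g ` ?I"
    by (rule set_eqI) (force simp: arcs_F)
  \<comment> \<open>Since \<open>k > 0\<close>, every arc has an inner end, and an inner vertex lies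
    on one path only.\<close>
  have same: "e = e'" if "e \<in> E" "e' \<in> E" "i \<le> k" "i' \<le> k"
    "P e i = P e' i' \<and> P e (Suc i) = P e' (Suc i') \<or> P e i = P e' (Suc i') \<and> P e (Suc i) = P e' i'"
    for e e' i i'
  proof (cases "i = 0")
    case True
    then show ?thesis
      using P_inner_eq[of "Suc i" "Suc i'" e e'] P_inner_eq[of "Suc i" i' e e'] that k_pos by auto
  next
    case False
    then show ?thesis
      using P_inner_eq[of i "Suc i'" e e'] P_inner_eq[of i i' e e'] that by auto
  qed
  have f: "inj_on ?f ?I"
  proof (rule inj_onI, clarsimp)
    fix a b a' b' i i'
    assume "(a, b) \<in> E" "(a', b') \<in> E" "i \<le> k" "i' \<le> k" "P (a, b) i = P (a', b') i'"
      "P (a, b) (Suc i) = P (a', b') (Suc i')"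
    then show "a = a' \<and> b = b' \<and> i = i'"
      using same[of "(a, b)" "(a', b')" i i'] P_inj[of "(a, b)" i i'] by auto
  qed
  have "inj_on ?g ?I"
  proof (rule inj_onI, clarsimp)
    fix a b a' b' i i'
    assume "(a, b) \<in> E" "(a', b') \<in> E" "i \<le> k" "i' \<le> k" "P (a, b) i = P (a', b') i'"
      "P (a, b) (Suc i) = P (a', b') (Suc i')"
    then show "a = a' \<and> b = b' \<and> i = i'"
      using same[of "(a, b)" "(a', b')" i i'] P_inj[of "(a, b)" i i'] by auto
  qed
  moreover have "?f ` ?I \<inter> ?g ` ?I = {}"
  proof -
    have False if "e \<in> E" "e' \<in> E" "i \<le> k" "i' \<le> k" "P e i = P e' (Suc i')" "P e (Suc i) = P e' i'"
      for e e' i i'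
    proof -
      have "e = e'" using same that by blast
      then have "i = Suc i'" "Suc i = i'" using P_inj that Suc_le_mono le_SucI by metis+
      then show False by simp
    qed
    then show ?thesis by fastforce
  qed
  ultimately have "card (parcs F) = card ?I + card ?I"
    unfolding parcs using f by (simp add: card_Un_disjoint card_image finite_E)
  then show ?thesis by (simp add: card_cartesian_product)
qed

section \<open>Upper bounds by charging vertices to paths\<close>

definition owner :: "'a subdiv_vertex \<Rightarrow> 'a subdiv_vertex \<Rightarrow> 'a \<times> 'a" where
  "owner a b = (case a of Inner u v i \<Rightarrow> (u, v) | Orig _ \<Rightarrow>
     (case b of Inner u v i \<Rightarrow> (u, v) | Orig x \<Rightarrow> (x, x)))"

text \<open>An inner end of the arc names the edge. The branch of \<open>owner\<close> for two
  original vertices is a dummy: as \<open>k > 0\<close>, no arc joins two of them.\<close>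

lemma owner_P:
  assumes "i \<le> Suc k" "j \<le> Suc k" "j = Suc i \<or> i = Suc j"
  shows "owner (P e i) (P e j) = e"
  using assms k_pos by (elim P_cases[of i e] P_cases[of j e]) (auto simp: owner_def)

lemma owner_arc:
  assumes "(a, b) \<in> parcs F"
  obtains i j where "owner a b \<in> E" "i \<le> Suc k" "j \<le> Suc k" "j = Suc i \<or> i = Suc j"
    "a = P (owner a b) i" "b = P (owner a b) j" "owner b a = owner a b"
  using assms
proof (cases rule: arcs_F_cases)
  case (1 e i j)
  then have "owner a b = e" "owner b a = e" using owner_P[of i j e] owner_P[of j i e] by auto
  then show thesis using 1 by (intro that[of i j]) auto
qed

lemma inner_step:
  assumes "(P e i, b) \<in> parcs F" "1 \<le> i" "i \<le> k" "e \<in> E"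
  shows "b = P e (i - 1) \<or> b = P e (Suc i)"
  using open_nbhd_inner[OF assms(4,2,3)] assms(1) by (auto simp: open_nbhd_def)

text \<open>Send each chosen end to the opposite end of its edge. Two chosen ends pointing at each
  other would belong to the same edge, which has only one chosen end. So the chosen ends form an
  orientable set.\<close>

lemma card_ends_le:
  assumes "T \<subseteq> E" and ends: "\<And>e. e \<in> T \<Longrightarrow> c e \<in> {fst e, snd e}" and inj: "inj_on c T"
  shows "card T \<le> orient_rank (parcs G)"
proof -
  define g where "g x = (let e = the_inv_into T c x in if fst e = x then snd e else fst e)" for x
  have inv: "the_inv_into T c (c e) = e" if "e \<in> T" for e
    using inj that by (rule the_inv_into_f_f)
  have ce: "{c e, g (c e)} = {fst e, snd e} \<and> c e \<noteq> g (c e)" if "e \<in> T" for e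
  proof -
    have "g (c e) = (if fst e = c e then snd e else fst e)"
      by (simp add: g_def inv[OF that] Let_def)
    moreover have "fst e \<noteq> snd e" using ends_E[of e] assms(1) that by auto
    moreover have "c e = fst e \<or> c e = snd e" using ends[OF that] by simp
    ultimately show ?thesis by (elim disjE) auto
  qed
  have "orients (parcs G) (c ` T) g"
    unfolding orients_def
  proof (intro ballI conjI impI)
    fix u assume "u \<in> c ` T"
    then obtain e where e: "e \<in> T" "u = c e" by blast
    then have "(fst e, snd e) \<in> parcs G" using assms(1) by (auto simp: E_def)
    then show "(u, g u) \<in> parcs G"
      using ce[OF e(1)] e(2) symD[OF sym_parcs] by (auto simp: doubleton_eq_iff)
    assume "g u \<in> c ` T"
    then obtain e' where e': "e' \<in> T" "g u = c e'" by blast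
    show "g (g u) \<noteq> u"
    proof
      assume "g (g u) = u"
      then have "{fst e', snd e'} = {g u, u}" using ce[OF e'(1)] e'(2) by simp
      moreover have "{fst e, snd e} = {u, g u}" using ce[OF e(1)] e(2) by simp
      ultimately have "{fst e, snd e} = {fst e', snd e'}" by (simp add: insert_commute)
      moreover have "fst e < snd e" "fst e' < snd e'" using ends_E assms(1) e e' by auto
      ultimately have "e = e'" by (auto simp: doubleton_eq_iff prod_eq_iff)
      then show False using ce[OF e(1)] e e' by auto
    qed
  qed
  then have "card (c ` T) \<le> orient_rank (parcs G)"
    by (intro card_le_orient_rank) (auto simp: orientable_def)
  then show ?thesis using card_image[OF inj] by simp
qed

text \<open>
  A vertex of \<open>W\<close> is charged to the path that contains the arc to its mate. An original vertex is
  charged to one path only, so the paths charged by an original vertex number at most the rank.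
\<close>

lemma card_le_by_paths:
  assumes W: "\<And>z. z \<in> W \<Longrightarrow> (z, m z) \<in> parcs F"
    and no_end: "\<And>e A. e \<in> E \<Longrightarrow> A = {z \<in> W. owner z (m z) = e} \<Longrightarrow> A \<subseteq> P e ` {1..k} \<Longrightarrow> card A \<le> c"
    and any: "\<And>e A. e \<in> E \<Longrightarrow> A = {z \<in> W. owner z (m z) = e} \<Longrightarrow> A \<subseteq> P e ` {0..Suc k} \<Longrightarrow> card A \<le> c + d"
  shows "card W \<le> c * card E + d * orient_rank (parcs G)"
proof -
  let ?A = "\<lambda>e. {z \<in> W. owner z (m z) = e}"
  \<comment> \<open>The paths charged by at least one original vertex; only these receive the extra
    \<open>d\<close>.\<close>
  define T where "T = {e \<in> E. \<exists>x. Orig x \<in> ?A e}"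
  have sub: "\<exists>i\<le>Suc k. z = P e i" if "z \<in> ?A e" for z e
  proof -
    have "z \<in> W" "owner z (m z) = e" using that by simp_all
    obtain i where "i \<le> Suc k" "z = P (owner z (m z)) i"
      using W[OF \<open>z \<in> W\<close>] by (rule owner_arc)
    then show ?thesis unfolding \<open>owner z (m z) = e\<close> by blast
  qed
  have end_of: "x \<in> {fst e, snd e}" if x: "Orig x \<in> ?A e" for x e
  proof -
    obtain i where "i \<le> Suc k" "Orig x = P e i" using sub[OF x] by blast
    then show ?thesis by (elim P_cases[of i e]) auto
  qed
  have finA: "finite (?A e)" for e
    using sub[of _ e] by (intro finite_subset[of "?A e" "P e ` {..Suc k}"]) auto
  have bound: "card (?A e) \<le> c + (if e \<in> T then d else 0)" if e: "e \<in> E" for e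
  proof (cases "e \<in> T")
    case True
    have "?A e \<subseteq> P e ` {0..Suc k}"
    proof
      fix z assume "z \<in> ?A e"
      then obtain i where "i \<le> Suc k" "z = P e i" using sub by blast
      then show "z \<in> P e ` {0..Suc k}" by simp
    qed
    then show ?thesis using any[OF e refl] True by simp
  next
    case False
    have "z \<in> P e ` {1..k}" if z: "z \<in> ?A e" for z
    proof -
      obtain i where i: "i \<le> Suc k" "z = P e i" using sub[OF z] by blast
      moreover have "z \<noteq> Orig x" for x using False z e by (auto simp: T_def)
      ultimately have "1 \<le> i \<and> i \<le> k" by (elim P_cases[of i e]) auto
      then show ?thesis using i by auto
    qed
    then have "?A e \<subseteq> P e ` {1..k}" by blast
    then show ?thesis using no_end[OF e refl] False by simp
  qed
  have "owner z (m z) \<in> E" if "z \<in> W" for z using W[OF that] by (rule owner_arc)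
  then have "W = (\<Union>e\<in>E. ?A e)" by blast
  then have "card W \<le> (\<Sum>e\<in>E. card (?A e))" using card_UN_le[OF finite_E, of ?A] by simp
  also have "\<dots> \<le> (\<Sum>e\<in>E. c + (if e \<in> T then d else 0))" using bound by (rule sum_mono)
  also have "\<dots> = c * card E + d * card T"
  proof -
    have "T \<subseteq> E" by (auto simp: T_def)
    then have "E \<inter> T = T" by blast
    then have "(\<Sum>e\<in>E. if e \<in> T then d else 0) = d * card T"
      using sum.inter_restrict[OF finite_E, of "\<lambda>_. d" T] by (simp add: mult.commute)
    then show ?thesis by (simp add: sum.distrib)
  qed
  also have "card T \<le> orient_rank (parcs G)"
  proof -
    \<comment> \<open>One charging original vertex per path of \<open>T\<close>; they are distinct
      because \<open>owner\<close> recovers the path from the vertex and its mate.\<close>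
    have "\<forall>e\<in>T. \<exists>x. Orig x \<in> ?A e" by (auto simp: T_def)
    then obtain c where c: "\<forall>e\<in>T. Orig (c e) \<in> ?A e" by (rule bchoice[THEN exE])
    show ?thesis
    proof (rule card_ends_le)
      show "T \<subseteq> E" by (auto simp: T_def)
      show "c e \<in> {fst e, snd e}" if "e \<in> T" for e using c that end_of by blast
      have "owner (Orig (c e)) (m (Orig (c e))) = e" if "e \<in> T" for e using c that by blast
      then show "inj_on c T" by (metis inj_onI)
    qed
  qed
  finally show ?thesis by simp
qed

text \<open>The inner vertices alone contribute at most \<open>k\<close> per path. With the ends
  there are \<open>k + 2\<close> vertices, which cannot all take distinct edges among the
  \<open>k + 1\<close> edges of the path.\<close>

lemma orient_rank_F_le: "orient_rank (parcs F) \<le> k * card E + orient_rank (parcs G)"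
proof -
  obtain S where S: "orientable (parcs F) S" "card S = orient_rank (parcs F)"
    using orient_rank_attained[OF finite_arcs_F] .
  then obtain f where f: "orients (parcs F) S f" by (auto simp: orientable_def)
  have "card S \<le> k * card E + 1 * orient_rank (parcs G)"
  proof (rule card_le_by_paths)
    show "(z, f z) \<in> parcs F" if "z \<in> S" for z using f that by (auto simp: orients_def)
  next
    fix e A assume "A \<subseteq> P e ` {1..k}"
    then have "card A \<le> card (P e ` {1..k})" by (intro card_mono) auto
    also have "\<dots> \<le> card {1..k}" by (rule card_image_le) simp
    finally show "card A \<le> k" by simp
  next
    fix e A assume e: "e \<in> E" and A: "A = {z \<in> S. owner z (f z) = e}" and sub: "A \<subseteq> P e ` {0..Suc k}"
    have "A \<noteq> P e ` {0..Suc k}"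
    proof
      assume all: "A = P e ` {0..Suc k}"
      have own: "P e i \<in> S" "owner (P e i) (f (P e i)) = e" if "i \<le> Suc k" for i
      proof -
        have "P e i \<in> A" unfolding all using that by simp
        then show "P e i \<in> S" "owner (P e i) (f (P e i)) = e" unfolding A by simp_all
      qed
      have arc: "(P e i, f (P e i)) \<in> parcs F" if "i \<le> Suc k" for i
        using own(1)[OF that] f by (auto simp: orients_def)
      have next_P: "\<exists>i' j'. i' \<le> Suc k \<and> j' \<le> Suc k \<and> (j' = Suc i' \<or> i' = Suc j') \<and>
        P e i = P e i' \<and> f (P e i) = P e j'" if "i \<le> Suc k" for i
        using arc[OF that] own(2)[OF that] by (elim owner_arc) auto
      have no_return: "f (f (P e i)) \<noteq> P e i" if "i \<le> Suc k" for i
      proof -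
        have "f (P e i) \<in> S" using next_P[OF that] own(1) by auto
        then show ?thesis using own(1)[OF that] f by (simp add: orients_def)
      qed
      have end_step: "f (P e i) = P e j"
        if "i = 0 \<and> j = 1 \<or> i = Suc k \<and> j = k" for i j
      proof -
        have i: "i \<le> Suc k" using that by auto
        obtain i' j' where *: "i' \<le> Suc k" "j' \<le> Suc k" "j' = Suc i' \<or> i' = Suc j'"
          "P e i = P e i'" "f (P e i) = P e j'"
          using next_P[OF i] by blast
        then have "i = i'" using P_inj[OF e i] by blast
        then show ?thesis using * that by auto
      qed
      \<comment> \<open>The first end forces every vertex on to its successor, so that
        \<open>P e k\<close> and the last end take the same edge.\<close>
      have "f (P e i) = P e (Suc i)" if "i \<le> k" for i
        using that
      proof (induction i)
        case 0
        then show ?case using end_step[of 0 1] by simp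
      next
        case (Suc i)
        then have "f (P e (Suc i)) \<noteq> P e i" using no_return[of i] by auto
        then show ?case using inner_step[OF arc[of "Suc i"]] Suc.prems e by auto
      qed
      from this[of k] have "f (f (P e k)) = P e k" using end_step[of "Suc k" k] by simp
      then show False using no_return[of k] by simp
    qed
    then have "A \<subset> P e ` {0..Suc k}" using sub by blast
    then have "card A < card (P e ` {0..Suc k})" by (intro psubset_card_mono) auto
    also have "\<dots> \<le> card {0..Suc k}" by (rule card_image_le) simp
    finally show "card A \<le> k + 1" by simp
  qed
  then show ?thesis using S by simp
qed

text \<open>Counts the \<open>2 |X|\<close> vertices of \<open>X\<close> and its private neighbours.
  Both members of a pair are charged to the same path, so each charge is even; this improves
  \<open>4q + 3\<close> to \<open>4q + 2\<close> for the interior and \<open>4q + 5\<close> to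
  \<open>4q + 4\<close> for the whole path.\<close>

lemma private_set_F_le:
  assumes k: "k = 4 * q + 3" and X: "private_set F X"
  shows "card X \<le> (2 * q + 1) * card E + orient_rank (parcs G)"
proof -
  obtain p where p: "\<And>x. x \<in> X \<Longrightarrow> p x \<in> pverts F - X \<and> open_nbhd F (p x) \<inter> X = {x}"
    using X unfolding private_set_def by metis
  have XV: "X \<subseteq> pverts F" using X by (simp add: private_set_def)
  have finX: "finite X" using XV finite_verts_F by (rule finite_subset)
  have injp: "inj_on p X" using p by (metis inj_onI singleton_inject)
  have arc: "(p x, x) \<in> parcs F" "(x, p x) \<in> parcs F" if "x \<in> X" for x
  proof -
    show "(p x, x) \<in> parcs F" using p[OF that] by (auto simp: open_nbhd_def)
    then show "(x, p x) \<in> parcs F" by (rule symD[OF sym_F])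
  qed
  \<comment> \<open>Pairs \<open>x\<close> with \<open>p x\<close> in both directions; the inverse
    exists because a private neighbour belongs to a single \<open>x\<close>.\<close>
  define m where "m z = (if z \<in> X then p z else the_inv_into X p z)" for z
  have m: "m x = p x" "m (p x) = x" if "x \<in> X" for x
    using that p by (auto simp: m_def the_inv_into_f_f[OF injp])
  have twice: "card (B \<union> p ` B) = 2 * card B" if "B \<subseteq> X" for B
  proof -
    have "p x \<notin> X" if "x \<in> X" for x using p[OF that] by simp
    then have "B \<inter> p ` B = {}" using that by auto
    moreover have "finite B" using that finX by (rule finite_subset)
    moreover have "inj_on p B" using injp that by (rule inj_on_subset)
    ultimately show ?thesis by (simp add: card_Un_disjoint card_image)
  qed
  have even: "even (card {z \<in> X \<union> p ` X. owner z (m z) = e})" for e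
  proof -
    let ?B = "{x \<in> X. owner x (p x) = e}"
    have "owner (p x) x = owner x (p x)" if "x \<in> X" for x using arc(2)[OF that] by (rule owner_arc)
    then have "{z \<in> X \<union> p ` X. owner z (m z) = e} = ?B \<union> p ` ?B" using m by auto
    then show ?thesis using twice[of ?B] by auto
  qed
  have "card (X \<union> p ` X) \<le> (4 * q + 2) * card E + 2 * orient_rank (parcs G)"
  proof (rule card_le_by_paths)
    show "(z, m z) \<in> parcs F" if "z \<in> X \<union> p ` X" for z using that arc m by auto
  next
    fix e A assume A: "A = {z \<in> X \<union> p ` X. owner z (m z) = e}" and "A \<subseteq> P e ` {1..k}"
    then have "card A \<le> card (P e ` {1..k})" by (intro card_mono) auto
    also have "\<dots> \<le> card {1..k}" by (rule card_image_le) simp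
    finally have "card A \<le> 4 * q + 3" using k by simp
    then show "card A \<le> 4 * q + 2" using even[of e] unfolding A[symmetric] by presburger
  next
    fix e A assume A: "A = {z \<in> X \<union> p ` X. owner z (m z) = e}" and "A \<subseteq> P e ` {0..Suc k}"
    then have "card A \<le> card (P e ` {0..Suc k})" by (intro card_mono) auto
    also have "\<dots> \<le> card {0..Suc k}" by (rule card_image_le) simp
    finally have "card A \<le> 4 * q + 5" using k by simp
    then show "card A \<le> 4 * q + 2 + 2" using even[of e] unfolding A[symmetric] by presburger
  qed
  then have "2 * card X \<le> 2 * ((2 * q + 1) * card E + orient_rank (parcs G))"
    using twice[of X] by (simp add: algebra_simps)
  then show ?thesis by simp
qed

section \<open>Lower bounds from an optimal orientation of the original graph\<close>

definition forward :: "'a set \<Rightarrow> ('a \<Rightarrow> 'a) \<Rightarrow> 'a \<times> 'a \<Rightarrow> bool" where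
  "forward S g e \<longleftrightarrow> fst e \<in> S \<and> g (fst e) = snd e"

text \<open>In the second case the edge is taken by its larger end, so the second clause of
  \<open>orients\<close> prevents the smaller end from taking it too. Edges taken by neither end
  also count as not \<open>forward\<close>.\<close>

lemma oriented_edge:
  assumes g: "orients (parcs G) S g" and u: "u \<in> S"
  obtains "u < g u" "(u, g u) \<in> E" "forward S g (u, g u)"
  | "g u < u" "(g u, u) \<in> E" "\<not> forward S g (g u, u)"
proof -
  have arc: "(u, g u) \<in> parcs G" and no: "g u \<in> S \<Longrightarrow> g (g u) \<noteq> u"
    using g u by (auto simp: orients_def)
  show thesis
  proof (cases "u < g u")
    case True
    then show thesis using that(1) arc u by (auto simp: E_def forward_def)
  next
    case False
    then have "(g u, u) \<in> E" using arc_E[OF arc] by (auto simp: E_def)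
    then show thesis using that(2) no ends_E[of "(g u, u)"] by (auto simp: forward_def)
  qed
qed

text \<open>On a forward path every inner vertex takes the edge to its successor, on all other paths
  the edge to its predecessor. The edge left over lies at the only end of the path that may take an
  edge there.\<close>

lemma orient_rank_F_ge: "k * card E + orient_rank (parcs G) \<le> orient_rank (parcs F)"
proof -
  obtain S where S: "orientable (parcs G) S" "card S = orient_rank (parcs G)"
    using orient_rank_attained[OF pair_finite_arcs] .
  then obtain g where g: "orients (parcs G) S g" by (auto simp: orientable_def)
  have SV: "S \<subseteq> pverts G" using g arc_fst_in_verts by (force simp: orients_def)
  define f where "f z = (case z of
      Orig u \<Rightarrow> (if u < g u then P (u, g u) 1 else P (g u, u) k)
    | Inner u v i \<Rightarrow> P (u, v) (if forward S g (u, v) then Suc i else i - 1))" for z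
  have f_Orig: "f (Orig u) = (if u < g u then P (u, g u) 1 else P (g u, u) k)" for u
    by (simp add: f_def)
  have f_P: "f (P e i) = P e (if forward S g e then Suc i else i - 1)" if "1 \<le> i" "i \<le> k" for e i
    using that by (simp add: f_def P_inner)
  let ?T = "Orig ` S \<union> (\<Union>e\<in>E. P e ` {1..k})"
  have Orig_T: "x \<in> S" if "Orig x \<in> ?T" for x
  proof -
    have "Orig x \<notin> P e ` {1..k}" for e using P_inner_neq_Orig[of _ e x] by force
    then show ?thesis using that by blast
  qed
  have "orients (parcs F) ?T f"
    unfolding orients_def
  proof
    fix z assume "z \<in> ?T"
    then consider u where "u \<in> S" "z = Orig u" | e i where "e \<in> E" "1 \<le> i" "i \<le> k" "z = P e i"
      by auto
    then show "(z, f z) \<in> parcs F \<and> (f z \<in> ?T \<longrightarrow> f (f z) \<noteq> z)"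
    proof cases
      case (1 u)
      show ?thesis
      proof (cases rule: oriented_edge[OF g \<open>u \<in> S\<close>])
        case *: 1
        have z: "z = P (u, g u) 0" "f z = P (u, g u) 1" using 1 * by (simp_all add: f_Orig)
        moreover have "f (f z) = P (u, g u) 2"
          using z(2) f_P[of 1 "(u, g u)"] *(3) k_pos by (simp add: numeral_2_eq_2)
        moreover have "P (u, g u) 2 \<noteq> P (u, g u) 0"
          using P_inj[OF *(2), of 2 0] k_pos by auto
        ultimately show ?thesis using P_arc[OF *(2), of 0 1] by simp
      next
        case *: 2
        have z: "z = P (g u, u) (Suc k)" "f z = P (g u, u) k" using 1 * by (auto simp: f_Orig)
        moreover have "f (f z) = P (g u, u) (k - 1)"
          using z(2) f_P[of k "(g u, u)"] *(3) k_pos by simp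
        moreover have "P (g u, u) (k - 1) \<noteq> P (g u, u) (Suc k)"
        proof
          assume "P (g u, u) (k - 1) = P (g u, u) (Suc k)"
          then have "k - 1 = Suc k" by (intro P_inj[OF *(2)]) auto
          then show False by simp
        qed
        ultimately show ?thesis using P_arc[OF *(2), of "Suc k" k] by simp
      qed
    next
      case (2 e i)
      define j where "j = (if forward S g e then Suc i else i - 1)"
      have fz: "f z = P e j" using 2 f_P by (simp add: j_def)
      have j: "j \<le> Suc k" "j = Suc i \<or> i = Suc j" using 2 by (auto simp: j_def)
      have "f (P e j) \<noteq> P e i" if "P e j \<in> ?T"
      proof (cases "1 \<le> j \<and> j \<le> k")
        case True
        define l where "l = (if forward S g e then Suc j else j - 1)"
        have "i \<noteq> l" "l \<le> Suc k" using 2 True by (auto simp: j_def l_def)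
        then have "P e l \<noteq> P e i" using P_inj[OF 2(1), of l i] 2 by auto
        then show ?thesis using f_P[of j e] True unfolding l_def by simp
      next
        case False
        \<comment> \<open>Here \<open>P e j\<close> is the end of the path that does not take the
          edge \<open>e\<close> under \<open>g\<close>; if it belongs to \<open>S\<close>, it takes
          an edge of another path.\<close>
        then consider "forward S g e" "j = Suc k" "i = k" | "\<not> forward S g e" "j = 0" "i = 1"
          using 2 by (force simp: j_def split: if_splits)
        then show ?thesis
        proof cases
          case *: 1
          have "Orig (snd e) \<in> ?T" using that unfolding *(2) P_last .
          then have "snd e \<in> S" by (rule Orig_T)
          then have no: "g (snd e) \<noteq> fst e" using * g by (auto simp: orients_def forward_def)
          show ?thesis
          proof
            assume "f (P e j) = P e i"
            then have "P e k = (if snd e < g (snd e) then P (snd e, g (snd e)) 1 else P (g (snd e), snd e) k)"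
              using * f_Orig[of "snd e"] by simp
            then have "e = (snd e, g (snd e)) \<or> e = (g (snd e), snd e)"
              using P_inner_eq[of k 1 e] P_inner_eq[of k k e] k_pos by (simp split: if_splits)
            then show False using no ends_E[OF 2(1)] by (auto simp: prod_eq_iff)
          qed
        next
          case *: 2
          have "Orig (fst e) \<in> ?T" using that unfolding *(2) P_0 .
          then have "fst e \<in> S" by (rule Orig_T)
          then have no: "g (fst e) \<noteq> snd e" using * by (auto simp: forward_def)
          show ?thesis
          proof
            assume "f (P e j) = P e i"
            then have "P e 1 = (if fst e < g (fst e) then P (fst e, g (fst e)) 1 else P (g (fst e), fst e) k)"
              using * f_Orig[of "fst e"] by simp
            then consider "P e 1 = P (fst e, g (fst e)) 1" | "P e 1 = P (g (fst e), fst e) k"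
              by (meson if_splits(1))
            then show False
            proof cases
              case 1
              have "e = (fst e, g (fst e))"
                by (rule P_inner_eq[of 1 1, THEN conjunct1]) (use 1 k_pos in simp_all)
              then have "snd e = snd (fst e, g (fst e))" by (rule arg_cong)
              then show False using no by simp
            next
              case 2
              have "e = (g (fst e), fst e)"
                by (rule P_inner_eq[of 1 k, THEN conjunct1]) (use 2 k_pos in simp_all)
              then have "snd e = snd (g (fst e), fst e)" by (rule arg_cong)
              then show False using ends_E[OF \<open>e \<in> E\<close>] by simp
            qed
          qed
        qed
      qed
      then show ?thesis using fz 2 P_arc[of e i j] j by simp
    qed
  qed
  then have "card ?T \<le> orient_rank (parcs F)"
    using finite_arcs_F by (intro card_le_orient_rank) (auto simp: orientable_def)
  moreover have "card ?T = card S + k * card E"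
    by (rule card_union_inner[where I = "\<lambda>_. {1..k}", OF SV]) auto
  ultimately show ?thesis using S by simp
qed

lemma mod4_0_pred:
  assumes "i mod 4 = (0::nat)" "1 \<le> i"
  shows "(i - 1) mod 4 = 3" "(i - 2) mod 4 = 2" "4 \<le> i"
proof -
  have "i = 4 * (i div 4)" using assms div_mult_mod_eq[of i 4] by linarith
  moreover obtain j where "i div 4 = Suc j" using assms calculation by (cases "i div 4") auto
  ultimately have "i = 4 * j + 4" by simp
  then show "(i - 1) mod 4 = 3" "(i - 2) mod 4 = 2" "4 \<le> i" by (simp_all add: mod_Suc)
qed

lemma mod4_3_pred:
  assumes "i mod 4 = (3::nat)"
  shows "(i - 1) mod 4 = 2" "(i - 2) mod 4 = 1" "3 \<le> i"
proof -
  have "i = 4 * (i div 4) + 3" using assms div_mult_mod_eq[of i 4] by linarith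
  then obtain j where "i = 4 * j + 3" ..
  then show "(i - 1) mod 4 = 2" "(i - 2) mod 4 = 1" "3 \<le> i" by (simp_all add: mod_Suc)
qed

text \<open>The top indices \<open>4q + 2\<close> and \<open>4q + 3\<close> have residues 2 and 3.
  This keeps both neighbours of a private neighbour at \<open>Suc i\<close> in the interior.\<close>

lemma mod4_0_1_add_2_le:
  assumes "i mod 4 = (0::nat) \<or> i mod 4 = 1" "i \<le> 4 * q + 3"
  shows "Suc (Suc i) \<le> 4 * q + 3"
proof -
  have i: "i = 4 * (i div 4) + i mod 4" "i mod 4 \<le> 1" using assms by auto
  then have "i div 4 \<le> q" using assms(2) by linarith
  then show ?thesis using i by linarith
qed

lemma card_residues_0_3: "card {i \<in> {1..4 * q + 3}. i mod 4 \<in> {0, 3::nat}} = 2 * q + 1"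
proof -
  have "{i \<in> {1..4 * q + 3}. i mod 4 \<in> {0, 3::nat}} = (\<lambda>j. 4 * j + 3) ` {..q} \<union> (\<lambda>j. 4 * j + 4) ` {..<q}"
    (is "?L = ?R")
  proof (intro set_eqI iffI)
    fix i assume i: "i \<in> ?L"
    then have "i mod 4 = 0 \<or> i mod 4 = 3" by simp
    then show "i \<in> ?R"
    proof
      assume "i mod 4 = 0"
      then have "i = 4 * (i div 4 - 1) + 4" "i div 4 - 1 < q" using i by auto
      then show ?thesis by blast
    next
      assume "i mod 4 = 3"
      then have "i = 4 * (i div 4) + 3" using div_mult_mod_eq[of i 4] by simp
      moreover from this have "i div 4 \<le> q" using i by auto
      ultimately show ?thesis by blast
    qed
  qed auto
  moreover have "(\<lambda>j. 4 * j + 3) ` {..q} \<inter> (\<lambda>j. 4 * j + 4) ` {..<q} = {}"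
    by auto presburger
  ultimately show ?thesis by (simp add: card_Un_disjoint card_image inj_on_def)
qed

lemma card_residues_0_1: "card {i \<in> {1..4 * q + 3}. i mod 4 \<in> {0, 1::nat}} = 2 * q + 1"
proof -
  have "{i \<in> {1..4 * q + 3}. i mod 4 \<in> {0, 1::nat}} = (\<lambda>j. 4 * j + 1) ` {..q} \<union> (\<lambda>j. 4 * j + 4) ` {..<q}"
    (is "?L = ?R")
  proof (intro set_eqI iffI)
    fix i assume i: "i \<in> ?L"
    then have "i mod 4 = 0 \<or> i mod 4 = 1" by simp
    then show "i \<in> ?R"
    proof
      assume "i mod 4 = 0"
      then have "i = 4 * (i div 4 - 1) + 4" "i div 4 - 1 < q" using i by auto
      then show ?thesis by blast
    next
      assume "i mod 4 = 1"
      then have "i = 4 * (i div 4) + 1" using div_mult_mod_eq[of i 4] by simp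
      moreover from this have "i div 4 \<le> q" using i by auto
      ultimately show ?thesis by blast
    qed
  qed auto
  moreover have "(\<lambda>j. 4 * j + 1) ` {..q} \<inter> (\<lambda>j. 4 * j + 4) ` {..<q} = {}"
    by auto presburger
  ultimately show ?thesis by (simp add: card_Un_disjoint card_image inj_on_def)
qed

text \<open>
  Along a path whose first vertex is oriented into it, the chosen vertices and their private
  neighbours follow the pattern \<open>x y y x x y y x \<dots>\<close>; along all other paths the same pattern is read
  from the far end.
\<close>

lemma ex_private_set_F:
  assumes k: "k = 4 * q + 3"
  obtains X where "private_set F X" "card X = (2 * q + 1) * card E + orient_rank (parcs G)"
proof -
  obtain S where S: "orientable (parcs G) S" "card S = orient_rank (parcs G)"
    using orient_rank_attained[OF pair_finite_arcs] .
  then obtain g where g: "orients (parcs G) S g" by (auto simp: orientable_def)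
  have SV: "S \<subseteq> pverts G" using g arc_fst_in_verts by (force simp: orients_def)
  have k2: "2 \<le> k" using k by simp
  \<comment> \<open>The residues of the positions \<open>x\<close> of the pattern. The far end has
    index \<open>4q + 4\<close>, a multiple of 4, so reading from there keeps residue 0 and
    exchanges 3 with 1.\<close>
  define R where "R e = {0, if forward S g e then 3 else 1::nat}" for e
  define I where "I e = {i \<in> {1..4 * q + 3}. i mod 4 \<in> R e}" for e
  define X where "X = Orig ` S \<union> (\<Union>e\<in>E. P e ` I e)"
  have inner: "P e i \<in> X \<longleftrightarrow> i mod 4 \<in> R e" if "e \<in> E" "1 \<le> i" "i \<le> k" for e i
  proof -
    have "P e i \<in> X \<longleftrightarrow> (\<exists>e'\<in>E. \<exists>j\<in>I e'. P e i = P e' j)"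
      using P_inner_neq_Orig[of i e] that by (auto simp: X_def)
    also have "\<dots> \<longleftrightarrow> i \<in> I e"
    proof
      assume "\<exists>e'\<in>E. \<exists>j\<in>I e'. P e i = P e' j"
      then obtain e' j where j: "j \<in> I e'" "P e i = P e' j" by blast
      then have "e = e' \<and> i = j" using P_inner_eq[of i j e e'] that by (simp add: I_def k)
      then show "i \<in> I e" using j by simp
    qed (use that in blast)
    finally show ?thesis using that k by (simp add: I_def)
  qed
  have priv: "\<exists>y\<in>pverts F - X. open_nbhd F y \<inter> X = {x}"
    if "e \<in> E" "x \<in> X" "1 \<le> i" "i \<le> k" "i mod 4 \<notin> R e"
      "x = P e (i - 1) \<and> Suc i \<le> k \<and> Suc i mod 4 \<notin> R e
       \<or> x = P e (Suc i) \<and> 2 \<le> i \<and> (i - 1) mod 4 \<notin> R e" for x e i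
  proof
    show "P e i \<in> pverts F - X" using that inner P_in_F by simp
    show "open_nbhd F (P e i) \<inter> X = {x}"
      using that(6)
    proof (elim disjE conjE)
      assume x: "x = P e (i - 1)" and "Suc i \<le> k" "Suc i mod 4 \<notin> R e"
      then have "P e (Suc i) \<notin> X" using inner[OF that(1), of "Suc i"] by simp
      then show ?thesis using open_nbhd_inner[OF that(1,3,4)] that(2) x by auto
    next
      assume x: "x = P e (Suc i)" and "2 \<le> i" "(i - 1) mod 4 \<notin> R e"
      then have "P e (i - 1) \<notin> X" using inner[OF that(1), of "i - 1"] that(4) by simp
      then show ?thesis using open_nbhd_inner[OF that(1,3,4)] that(2) x by auto
    qed
  qed
  have "private_set F X"
    unfolding private_set_def
  proof (intro conjI ballI)
    have "Orig ` S \<subseteq> pverts F" using SV by (auto simp: verts_F)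
    moreover have "P e ` I e \<subseteq> pverts F" if "e \<in> E" for e
      using P_in_F[OF that] by (auto simp: I_def k)
    ultimately show "X \<subseteq> pverts F" unfolding X_def by blast
  next
    fix x assume xX: "x \<in> X"
    then consider u where "u \<in> S" "x = Orig u" | e i where "e \<in> E" "i \<in> I e" "x = P e i"
      unfolding X_def by blast
    then show "\<exists>y\<in>pverts F - X. open_nbhd F y \<inter> X = {x}"
    proof cases
      case (1 u)
      show ?thesis
      proof (cases rule: oriented_edge[OF g \<open>u \<in> S\<close>])
        case *: 1
        show ?thesis
          by (rule priv[OF *(2) xX, of 1]) (use * 1 k2 in \<open>auto simp: R_def\<close>)
      next
        case *: 2
        have "k mod 4 = 3" "(k - 1) mod 4 = 2" unfolding k by (simp_all add: mod_Suc)
        then show ?thesis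
          by (intro priv[OF *(2) xX, of k]) (use * 1 k2 in \<open>auto simp: R_def\<close>)
      qed
    next
      case (2 e i)
      have i: "1 \<le> i" "i \<le> k" "i mod 4 \<in> R e" using 2 by (auto simp: I_def k)
      show ?thesis
      proof (cases "forward S g e")
        case True
        then have R: "R e = {0, 3}" by (simp add: R_def)
        show ?thesis
        proof (cases "i mod 4 = 0")
          case True
          then have "Suc i mod 4 = 1" "Suc (Suc i) mod 4 = 2" "Suc (Suc i) \<le> k"
            using mod4_0_1_add_2_le[of i q] i k by (simp_all add: mod_Suc)
          then show ?thesis
            by (intro priv[OF 2(1) xX, of "Suc i"]) (auto simp: R 2)
        next
          case False
          then have "i mod 4 = 3" using i R by simp
          from mod4_3_pred[OF this] have "(i - 1) mod 4 = 2" "(i - 2) mod 4 = 1" "3 \<le> i" .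
          then show ?thesis
            using i by (intro priv[OF 2(1) xX, of "i - 1"]) (auto simp: R 2 numeral_2_eq_2)
        qed
      next
        case False
        then have R: "R e = {0, 1}" by (simp add: R_def)
        show ?thesis
        proof (cases "i mod 4 = 0")
          case True
          then have "(i - 1) mod 4 = 3" "(i - 2) mod 4 = 2" "4 \<le> i"
            using i(1) by (rule mod4_0_pred)+
          then show ?thesis
            using i by (intro priv[OF 2(1) xX, of "i - 1"]) (auto simp: R 2 numeral_2_eq_2)
        next
          case False
          then have "i mod 4 = 1" using i R by simp
          then have "Suc i mod 4 = 2" "Suc (Suc i) mod 4 = 3" "Suc (Suc i) \<le> k"
            using mod4_0_1_add_2_le[of i q] i k by (simp_all add: mod_Suc)
          then show ?thesis
            by (intro priv[OF 2(1) xX, of "Suc i"]) (auto simp: R 2)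
        qed
      qed
    qed
  qed
  moreover have "card X = card S + (2 * q + 1) * card E"
    unfolding X_def
  proof (rule card_union_inner[OF SV])
    show "I e \<subseteq> {1..k}" for e by (auto simp: I_def k)
    show "card (I e) = 2 * q + 1" for e
      using card_residues_0_1 card_residues_0_3 by (simp add: I_def R_def)
  qed
  ultimately show thesis using that S by simp
qed

text \<open>Every edge is two arcs, so \<open>card (parcs F) div 4\<close> is half the number of
  edges. The additive form keeps truncated subtraction out.\<close>

lemma super_domination_number_F:
  assumes k: "k = 4 * q + 3"
  shows "super_domination_number F + orient_rank (parcs F) = card (pverts F) + card (parcs F) div 4"
proof -
  obtain X where X: "private_set F X" "card X = (2 * q + 1) * card E + orient_rank (parcs G)"
    using ex_private_set_F[OF k] .
  have "super_domination_number F = card (pverts F) - card X"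
    by (rule super_domination_number_eqI[OF finite_verts_F sym_F X(1)])
      (use X(2) private_set_F_le[OF k] in simp)
  moreover have "card X \<le> card (pverts F)"
    using X(1) finite_verts_F card_mono by (auto simp: private_set_def)
  moreover have "orient_rank (parcs F) = k * card E + orient_rank (parcs G)"
    using orient_rank_F_le orient_rank_F_ge by simp
  moreover have "card (parcs F) div 4 = (2 * q + 2) * card E"
  proof -
    have "2 * (Suc k * n) = 4 * ((2 * q + 2) * n)" for n by (simp add: k algebra_simps)
    then show ?thesis unfolding card_arcs_F by simp
  qed
  moreover have "k * n = (2 * q + 1) * n + (2 * q + 2) * n" for n by (simp add: k algebra_simps)
  ultimately show ?thesis using X(2) by simp
qed

end

text \<open>The divisibility matters to the program: it divides by subtracting 4 repeatedly, and
  truncated subtraction would round a remainder up.\<close>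

lemma super_domination_number_subdivision_graph:
  fixes F :: "'a pair_pre_digraph"
  assumes F: "k_subdivision_graph k F" and k: "k = 4 * q + 3"
  shows "super_domination_number F + orient_rank (parcs F) = card (pverts F) + card (parcs F) div 4"
    and "4 dvd card (parcs F)"
proof -
  obtain G :: "nat pair_pre_digraph" where G: "pair_graph G"
    "digraph_iso (with_proj (k_subdivision k G)) (with_proj F)"
    using F unfolding k_subdivision_graph_def by blast
  interpret subdivided_graph G k
    using G(1) k by (simp add: subdivided_graph_def subdivided_graph_axioms_def)
  let ?S = "k_subdivision k G"
  obtain h where h: "pre_digraph.digraph_isomorphism (with_proj ?S) h"
    "with_proj F = app_iso h (with_proj ?S)"
    using G(2) unfolding digraph_iso_def by blast
  have inj: "inj_on (iso_verts h) (pverts ?S)"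
    using h(1) unfolding pre_digraph.digraph_isomorphism_def by simp
  have verts: "pverts F = iso_verts h ` pverts ?S"
    using arg_cong[OF h(2), of verts] by simp
  \<comment> \<open>Tails and heads are \<open>fst\<close> and \<open>snd\<close> on both sides, so
    the arc map of the isomorphism is determined by its vertex map.\<close>
  have "iso_arcs h a = map_prod (iso_verts h) (iso_verts h) a" if "a \<in> parcs ?S" for a
  proof -
    have "iso_tail h = fst" "iso_head h = snd"
      using arg_cong[OF h(2), of tail] arg_cong[OF h(2), of head] by simp_all
    then show ?thesis
      using h(1) that unfolding pre_digraph.digraph_isomorphism_def by (simp add: prod_eq_iff)
  qed
  then have arcs: "parcs F = map_prod (iso_verts h) (iso_verts h) ` parcs ?S"
    using arg_cong[OF h(2), of arcs] by simp
  have Field: "Field (parcs ?S) \<subseteq> pverts ?S" using parcs_F_subset by (auto simp: Field_def)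
  have "super_domination_number F = super_domination_number ?S"
    by (rule super_domination_number_image[OF finite_verts_F inj parcs_F_subset verts arcs])
  moreover have "orient_rank (parcs F) = orient_rank (parcs ?S)"
    unfolding arcs using inj Field by (intro orient_rank_image finite_arcs_F) (rule inj_on_subset)
  moreover have "card (pverts F) = card (pverts ?S)" unfolding verts by (rule card_image[OF inj])
  moreover have arcs_S: "card (parcs F) = card (parcs ?S)"
  proof -
    have "inj_on (map_prod (iso_verts h) (iso_verts h)) (pverts ?S \<times> pverts ?S)"
      using inj by (intro map_prod_inj_on)
    then show ?thesis unfolding arcs by (intro card_image) (rule inj_on_subset[OF _ parcs_F_subset])
  qed
  ultimately show "super_domination_number F + orient_rank (parcs F) = card (pverts F) + card (parcs F) div 4"
    using super_domination_number_F[OF k] by simp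
  have "2 * (Suc k * m) = 4 * ((2 * q + 2) * m)" for m by (simp add: k algebra_simps)
  then show "4 dvd card (parcs F)" unfolding arcs_S card_arcs_F by simp
qed

section \<open>The program\<close>

definition reaches :: "instr list \<Rightarrow> nat \<Rightarrow> nat \<Rightarrow> config \<Rightarrow> (config \<Rightarrow> bool) \<Rightarrow> bool" where
  "reaches P b T c Q \<longleftrightarrow>
     (\<exists>t\<le>T. Q ((step P ^^ t) c) \<and> (\<forall>s\<le>t. words_le b ((step P ^^ s) c)))"

text \<open>\<open>reaches\<close> keeps the word bound at every intermediate configuration, so that
  composing segments gives time and word size at once. \<open>bounded_run\<close> is the form for
  segments of literal length: its recursion equations unfold into a symbolic execution.\<close>

definition bounded_run :: "instr list \<Rightarrow> nat \<Rightarrow> nat \<Rightarrow> config \<Rightarrow> bool" where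
  "bounded_run P b t c \<longleftrightarrow> (\<forall>s\<le>t. words_le b ((step P ^^ s) c))"

lemma bounded_run_0: "bounded_run P b 0 c \<longleftrightarrow> words_le b c"
  by (simp add: bounded_run_def)

lemma bounded_run_Suc: "bounded_run P b (Suc t) c \<longleftrightarrow> words_le b c \<and> bounded_run P b t (step P c)"
  unfolding bounded_run_def
proof (intro iffI conjI allI impI)
  assume *: "\<forall>s\<le>Suc t. words_le b ((step P ^^ s) c)"
  show "words_le b c" using *[rule_format, of 0] by simp
  show "words_le b ((step P ^^ s) (step P c))" if "s \<le> t" for s
    using *[rule_format, of "Suc s"] that by (simp add: funpow_swap1)
next
  fix s assume *: "words_le b c \<and> (\<forall>s\<le>t. words_le b ((step P ^^ s) (step P c)))" "s \<le> Suc t"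
  then show "words_le b ((step P ^^ s) c)" by (cases s) (auto simp: funpow_swap1)
qed

lemma bounded_run_numeral:
  "bounded_run P b (numeral m) c \<longleftrightarrow> words_le b c \<and> bounded_run P b (pred_numeral m) (step P c)"
  by (simp add: numeral_eq_Suc bounded_run_Suc)

lemma funpow_step_numeral: "(step P ^^ numeral m) c = (step P ^^ pred_numeral m) (step P c)"
  by (simp add: numeral_eq_Suc funpow_swap1)

lemma step_exec: "pc c < length P \<Longrightarrow> step P c = exec (P ! pc c) c"
  by (simp add: step_def halted_def)

lemma reachesI: "bounded_run P b t c \<Longrightarrow> Q ((step P ^^ t) c) \<Longrightarrow> t \<le> T \<Longrightarrow> reaches P b T c Q"
  unfolding reaches_def bounded_run_def by blast

lemma reaches_trans:
  assumes "reaches P b T c Q" and "\<And>d. Q d \<Longrightarrow> reaches P b T' d Q'"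
  shows "reaches P b (T + T') c Q'"
proof -
  obtain t where t: "t \<le> T" "Q ((step P ^^ t) c)" "\<And>s. s \<le> t \<Longrightarrow> words_le b ((step P ^^ s) c)"
    using assms(1) unfolding reaches_def by blast
  obtain t' where t': "t' \<le> T'" "Q' ((step P ^^ t') ((step P ^^ t) c))"
    "\<And>s. s \<le> t' \<Longrightarrow> words_le b ((step P ^^ s) ((step P ^^ t) c))"
    using assms(2)[OF t(2)] unfolding reaches_def by blast
  have "words_le b ((step P ^^ s) c)" if "s \<le> t' + t" for s
  proof (cases "s \<le> t")
    case False
    then have "s = (s - t) + t" by simp
    then have "(step P ^^ s) c = (step P ^^ (s - t)) ((step P ^^ t) c)"
      by (metis comp_apply funpow_add)
    then show ?thesis using t'(3)[of "s - t"] that by simp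
  qed (use t in simp)
  moreover have "Q' ((step P ^^ (t' + t)) c)" using t'(2) by (simp add: funpow_add)
  ultimately show ?thesis unfolding reaches_def
    using t(1) t'(1) by (intro exI[of _ "t' + t"]) auto
qed

lemma reaches_mono: "reaches P b T c Q \<Longrightarrow> T \<le> T' \<Longrightarrow> reaches P b T' c Q"
  unfolding reaches_def by (meson le_trans)

lemma reaches_trans_le:
  assumes "reaches P b T c Q" "\<And>d. Q d \<Longrightarrow> reaches P b T' d Q'" "T + T' \<le> T''"
  shows "reaches P b T'' c Q'"
  using reaches_trans[OF assms(1,2)] assms(3) by (rule reaches_mono)

lemma funpow_step_halted: "halted P c \<Longrightarrow> (step P ^^ t) c = c"
  by (induction t) (simp_all add: step_def)

text \<open>A halted configuration no longer changes, so a bound on the finite run is a bound for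
  all times, as linear time computability demands.\<close>

lemma words_le_after_halting:
  assumes "halted P ((step P ^^ t) c)" "\<And>s. s \<le> t \<Longrightarrow> words_le b ((step P ^^ s) c)"
  shows "words_le b ((step P ^^ s) c)"
proof (cases "s \<le> t")
  case False
  then have "s = (s - t) + t" by simp
  then have "(step P ^^ s) c = (step P ^^ (s - t)) ((step P ^^ t) c)"
    by (metis comp_apply funpow_add)
  then show ?thesis using assms funpow_step_halted by simp
qed (use assms in simp)

text \<open>Like \<open>set_reg\<close>, the operations \<open>set_mem\<close> and
  \<open>goto\<close> stay folded, so that simplification works with their projections rather than
  with nested record updates.\<close>

definition set_mem :: "nat \<Rightarrow> nat \<Rightarrow> config \<Rightarrow> config" where
  "set_mem a x c = c\<lparr> pc := pc c + 1, mem := (mem c)(a := x) \<rparr>"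

definition goto :: "nat \<Rightarrow> config \<Rightarrow> config" where
  "goto l c = c\<lparr> pc := l \<rparr>"

lemma set_reg_simps:
  "pc (set_reg r x c) = pc c + 1" "reg (set_reg r x c) = (reg c)(r := x)" "mem (set_reg r x c) = mem c"
  by (simp_all add: set_reg_def)

lemma set_mem_simps:
  "pc (set_mem a x c) = pc c + 1" "reg (set_mem a x c) = reg c" "mem (set_mem a x c) = (mem c)(a := x)"
  by (simp_all add: set_mem_def)

lemma goto_simps: "pc (goto l c) = l" "reg (goto l c) = reg c" "mem (goto l c) = mem c"
  by (simp_all add: goto_def)

lemma words_le_update:
  "words_le b c \<Longrightarrow> words_le b (set_reg r x c) \<longleftrightarrow> x \<le> b"
  "words_le b c \<Longrightarrow> words_le b (set_mem a x c) \<longleftrightarrow> x \<le> b"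
  "words_le b (goto l c) \<longleftrightarrow> words_le b c"
  by (auto simp: words_le_def set_reg_def set_mem_def goto_def)

lemma exec_update:
  "exec (Const r n) c = set_reg r n c"
  "exec (Add r s t) c = set_reg r (reg c s + reg c t) c"
  "exec (Sub r s t) c = set_reg r (reg c s - reg c t) c"
  "exec (Load r s) c = set_reg r (mem c (reg c s)) c"
  "exec (Store r s) c = set_mem (reg c r) (reg c s) c"
  "exec (Jump_Zero r l) c = goto (if reg c r = 0 then l else pc c + 1) c"
  by (simp_all add: set_mem_def goto_def)

declare exec.simps [simp del]

lemmas run_simps = set_reg_simps set_mem_simps goto_simps exec_update step_exec
  bounded_run_0 bounded_run_numeral bounded_run_Suc funpow_step_numeral words_le_update

text \<open>
  Registers: \<open>0\<close> accumulates the result; \<open>1\<close> to \<open>4\<close> hold \<open>n\<close>, \<open>1\<close>, \<open>4\<close>, \<open>0\<close>; \<open>8\<close> and \<open>9\<close> hold the addresses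
  \<open>L\<close> and \<open>L + n\<close> of the tables of degrees and neighbour sums, which are stored behind the input of
  length \<open>L\<close>. Jumps on register \<open>4\<close> are unconditional. Loop heads: \<open>5\<close> measures the input, \<open>16\<close>
  divides the number of arcs by \<open>4\<close>, \<open>24\<close> and \<open>29\<close> fill the tables, \<open>42\<close> runs through the vertices and
  \<open>44\<close> strips leaves as long as the removal of one creates another, \<open>69\<close> subtracts the number of
  remaining nonisolated vertices.
\<close>

definition program :: "instr list" where
  "program =
    [Const 2 1, Const 3 4, Load 1 4, Const 5 1, Add 6 1 4,
     Jump_Zero 6 11, Load 7 5, Add 5 5 7, Add 5 5 2, Sub 6 6 2, Jump_Zero 4 5,
     Add 8 5 4, Add 9 8 1, Sub 10 8 2, Sub 10 10 1, Add 0 1 4,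
     Jump_Zero 10 20, Sub 10 10 3, Add 0 0 2, Jump_Zero 4 16,
     Const 5 1, Add 6 1 4, Add 11 8 4, Add 12 9 4,
     Jump_Zero 6 40, Load 7 5, Store 11 7, Add 5 5 2, Const 13 0,
     Jump_Zero 7 35, Load 14 5, Add 13 13 14, Add 5 5 2, Sub 7 7 2, Jump_Zero 4 29,
     Store 12 13, Add 11 11 2, Add 12 12 2, Sub 6 6 2, Jump_Zero 4 24,
     Const 5 0, Add 6 1 4,
     Jump_Zero 6 67, Add 11 5 4,
     Add 7 8 11, Load 13 7, Jump_Zero 13 64, Sub 13 13 2, Jump_Zero 13 50, Jump_Zero 4 64,
     Add 14 9 11, Load 12 14, Store 7 4, Add 7 8 12, Load 13 7, Sub 13 13 2, Store 7 13,
     Add 7 9 12, Load 13 7, Sub 13 13 11, Store 7 13, Sub 0 0 2, Add 11 12 4, Jump_Zero 4 44,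
     Add 5 5 2, Sub 6 6 2, Jump_Zero 4 42,
     Add 5 8 4, Add 6 1 4,
     Jump_Zero 6 76, Load 7 5, Jump_Zero 7 73, Sub 0 0 2, Add 5 5 2, Sub 6 6 2, Jump_Zero 4 69]"

lemma length_program: "length program = 76"
  by (simp add: program_def)

lemma program_nth:
  "program ! 0 = Const 2 1" "program ! Suc 0 = Const 3 4" "program ! Suc (Suc 0) = Load 1 4"
  "program ! 3 = Const 5 1" "program ! 4 = Add 6 1 4"
  "program ! 5 = Jump_Zero 6 11" "program ! 6 = Load 7 5" "program ! 7 = Add 5 5 7"
  "program ! 8 = Add 5 5 2" "program ! 9 = Sub 6 6 2" "program ! 10 = Jump_Zero 4 5"
  "program ! 11 = Add 8 5 4" "program ! 12 = Add 9 8 1" "program ! 13 = Sub 10 8 2"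
  "program ! 14 = Sub 10 10 1" "program ! 15 = Add 0 1 4"
  "program ! 16 = Jump_Zero 10 20" "program ! 17 = Sub 10 10 3" "program ! 18 = Add 0 0 2"
  "program ! 19 = Jump_Zero 4 16"
  "program ! 20 = Const 5 1" "program ! 21 = Add 6 1 4" "program ! 22 = Add 11 8 4"
  "program ! 23 = Add 12 9 4"
  "program ! 24 = Jump_Zero 6 40" "program ! 25 = Load 7 5" "program ! 26 = Store 11 7"
  "program ! 27 = Add 5 5 2" "program ! 28 = Const 13 0"
  "program ! 29 = Jump_Zero 7 35" "program ! 30 = Load 14 5" "program ! 31 = Add 13 13 14"
  "program ! 32 = Add 5 5 2" "program ! 33 = Sub 7 7 2" "program ! 34 = Jump_Zero 4 29"
  "program ! 35 = Store 12 13" "program ! 36 = Add 11 11 2" "program ! 37 = Add 12 12 2"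
  "program ! 38 = Sub 6 6 2" "program ! 39 = Jump_Zero 4 24"
  "program ! 40 = Const 5 0" "program ! 41 = Add 6 1 4"
  "program ! 42 = Jump_Zero 6 67" "program ! 43 = Add 11 5 4"
  "program ! 44 = Add 7 8 11" "program ! 45 = Load 13 7" "program ! 46 = Jump_Zero 13 64"
  "program ! 47 = Sub 13 13 2" "program ! 48 = Jump_Zero 13 50" "program ! 49 = Jump_Zero 4 64"
  "program ! 50 = Add 14 9 11" "program ! 51 = Load 12 14" "program ! 52 = Store 7 4"
  "program ! 53 = Add 7 8 12" "program ! 54 = Load 13 7" "program ! 55 = Sub 13 13 2"
  "program ! 56 = Store 7 13" "program ! 57 = Add 7 9 12" "program ! 58 = Load 13 7"
  "program ! 59 = Sub 13 13 11" "program ! 60 = Store 7 13" "program ! 61 = Sub 0 0 2"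
  "program ! 62 = Add 11 12 4" "program ! 63 = Jump_Zero 4 44"
  "program ! 64 = Add 5 5 2" "program ! 65 = Sub 6 6 2" "program ! 66 = Jump_Zero 4 42"
  "program ! 67 = Add 5 8 4" "program ! 68 = Add 6 1 4"
  "program ! 69 = Jump_Zero 6 76" "program ! 70 = Load 7 5" "program ! 71 = Jump_Zero 7 73"
  "program ! 72 = Sub 0 0 2" "program ! 73 = Add 5 5 2" "program ! 74 = Sub 6 6 2"
  "program ! 75 = Jump_Zero 4 69"
  by (simp_all add: program_def)

lemma program_nth_Suc:
  "program ! Suc (Suc (Suc 0)) = Const 5 1" "program ! Suc (Suc (Suc (Suc 0))) = Add 6 1 4"
  by (simp_all add: program_def)

lemmas exec_simps = run_simps length_program program_nth program_nth_Suc

section \<open>The layout of the input in memory\<close>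

definition offset :: "nat list list \<Rightarrow> nat \<Rightarrow> nat" where
  "offset adj j = Suc (\<Sum>i<j. Suc (length (adj ! i)))"

text \<open>Origin of the word bound: \<open>L + 2 * n\<close> covers all addresses, since both
  tables lie behind the input, \<open>n * n\<close> covers the neighbour sums, and 4 is the constant
  in register 3.\<close>

locale adjacency_input =
  fixes adj :: "nat list list" and b n L :: nat and M :: "nat \<Rightarrow> nat"
  defines "n \<equiv> length adj"
    and "L \<equiv> offset adj n"
    and "M \<equiv> mem (init_config (encode adj))"
  assumes bound: "L + 2 * n \<le> b" "n * n \<le> b" "4 \<le> b"
    and distinct_adj: "i < n \<Longrightarrow> distinct (adj ! i)"
    and adj_less: "i < n \<Longrightarrow> j \<in> set (adj ! i) \<Longrightarrow> j < n"
begin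

lemma offset_Suc: "offset adj (Suc j) = Suc (offset adj j + length (adj ! j))"
  by (simp add: offset_def)

lemma offset_mono: "i \<le> j \<Longrightarrow> offset adj i \<le> offset adj j"
  by (rule lift_Suc_mono_le[of "offset adj"]) (simp_all add: offset_Suc)

lemma encode_drop:
  assumes "j \<le> n"
  shows "drop (offset adj j) (encode adj) = concat (map (\<lambda>ns. length ns # ns) (drop j adj))"
  using assms
proof (induction j)
  case 0
  then show ?case by (simp add: offset_def encode_def)
next
  case (Suc j)
  have "drop (offset adj (Suc j)) (encode adj) =
      drop (Suc (length (adj ! j))) (drop (offset adj j) (encode adj))"
    by (simp add: offset_Suc add.commute)
  also have "\<dots> = concat (map (\<lambda>ns. length ns # ns) (drop (Suc j) adj))"
    using Suc by (simp add: n_def Cons_nth_drop_Suc[symmetric])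
  finally show ?case .
qed

lemma length_encode: "length (encode adj) = L"
proof -
  have "length (encode adj) = Suc (\<Sum>ns\<leftarrow>adj. Suc (length ns))"
    by (simp add: encode_def length_concat o_def)
  also have "\<dots> = L" by (simp add: L_def offset_def n_def sum_list_sum_nth atLeast0LessThan)
  finally show ?thesis .
qed

lemma M_0: "M 0 = n"
  by (simp add: M_def init_config_def encode_def n_def)

lemma M_eq:
  assumes "j < n" "i \<le> length (adj ! j)"
  shows "M (offset adj j + i) = (length (adj ! j) # adj ! j) ! i"
proof -
  have "offset adj (Suc j) \<le> L" using assms offset_mono by (simp add: L_def)
  then have less: "offset adj j + i < length (encode adj)"
    using assms by (simp add: length_encode offset_Suc)
  then have "M (offset adj j + i) = drop (offset adj j) (encode adj) ! i"
    by (simp add: M_def init_config_def)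
  also have "\<dots> = (length (adj ! j) # adj ! j) ! i"
    using assms encode_drop[of j]
    by (simp add: n_def Cons_nth_drop_Suc[symmetric] nth_append nth_Cons split: nat.split)
  finally show ?thesis .
qed

lemma M_degree: "j < n \<Longrightarrow> M (offset adj j) = length (adj ! j)"
  using M_eq[of j 0] by simp

lemma M_neighbour: "j < n \<Longrightarrow> i < length (adj ! j) \<Longrightarrow> M (Suc (offset adj j + i)) = adj ! j ! i"
  using M_eq[of j "Suc i"] by simp

lemma degree_le: "j < n \<Longrightarrow> length (adj ! j) \<le> n"
  using distinct_adj[of j] adj_less[of j] card_mono[of "{..<n}" "set (adj ! j)"]
  by (auto simp: distinct_card)

lemma words_le_init: "words_le b (init_config (encode adj))"
proof -
  have n_b: "n \<le> b" using bound(1) by simp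
  have "x \<le> b" if "x \<in> set (encode adj)" for x
  proof -
    have "x = n \<or> (\<exists>ns\<in>set adj. x = length ns \<or> x \<in> set ns)"
      using that by (auto simp: encode_def n_def)
    then consider "x = n" | ns where "ns \<in> set adj" "x = length ns \<or> x \<in> set ns"
      by blast
    then show ?thesis
    proof cases
      case (2 ns)
      then obtain i where "i < n" "ns = adj ! i" by (auto simp: in_set_conv_nth n_def)
      then have "x \<le> n" using 2 degree_le[of i] adj_less[of i x] by auto
      then show ?thesis using n_b by simp
    qed (use n_b in simp)
  qed
  then show ?thesis by (auto simp: words_le_def init_config_def)
qed

section \<open>Reading the input: its length, the number of arcs, the tables\<close>

definition base :: "nat \<Rightarrow> config \<Rightarrow> bool" where
  "base l c \<longleftrightarrow> pc c = l \<and> reg c 1 = n \<and> reg c 2 = 1 \<and> reg c 3 = 4 \<and> reg c 4 = 0 \<and> words_le b c"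

lemma start:
  "reaches program b 5 (init_config (encode adj))
     (\<lambda>c. base 5 c \<and> reg c 5 = offset adj 0 \<and> reg c 6 = n \<and> mem c = M)"
proof (rule reachesI)
  let ?c = "init_config (encode adj)"
  have c: "pc ?c = 0" "\<And>r. reg ?c r = 0" "mem ?c = M" "words_le b ?c"
    using words_le_init by (simp_all add: M_def init_config_def)
  have "1 \<le> b" "n \<le> b" using bound by auto
  note facts = c this bound(3)
  show "bounded_run program b 5 ?c" using facts by (simp add: exec_simps M_0)
  show "base 5 ((step program ^^ 5) ?c) \<and> reg ((step program ^^ 5) ?c) 5 = offset adj 0 \<and>
     reg ((step program ^^ 5) ?c) 6 = n \<and> mem ((step program ^^ 5) ?c) = M"
    using facts by (simp add: exec_simps M_0 base_def offset_def)
qed simp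

lemma measure_input:
  assumes "base 5 c" "reg c 5 = offset adj j" "reg c 6 = n - j" "mem c = M" "j \<le> n"
  shows "reaches program b (6 * (n - j) + 1) c (\<lambda>c. base 11 c \<and> reg c 5 = L \<and> mem c = M)"
  using assms
proof (induction "n - j" arbitrary: j c)
  case 0
  then show ?case
    by (intro reachesI[of _ _ 1]) (simp_all add: exec_simps base_def L_def)
next
  case (Suc m)
  have j: "j < n" using Suc.hyps(2) by simp
  have "offset adj (Suc j) \<le> L" using j offset_mono by (simp add: L_def)
  then have le: "offset adj j + length (adj ! j) \<le> b" "Suc (offset adj j + length (adj ! j)) \<le> b"
    "length (adj ! j) \<le> b" "n - Suc j \<le> b" "offset adj j \<le> b"
    using bound(1) by (auto simp: offset_Suc)
  note facts = Suc.prems(1-4)[unfolded base_def] M_degree[OF j] le j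
  show ?case
  proof (rule reaches_trans_le)
    show "reaches program b 6 c
      (\<lambda>c. base 5 c \<and> reg c 5 = offset adj (Suc j) \<and> reg c 6 = n - Suc j \<and> mem c = M)"
      by (rule reachesI[of _ _ 6]) (use facts in \<open>simp_all add: exec_simps base_def offset_Suc\<close>)
    show "reaches program b (6 * (n - Suc j) + 1) d (\<lambda>c. base 11 c \<and> reg c 5 = L \<and> mem c = M)"
      if "base 5 d \<and> reg d 5 = offset adj (Suc j) \<and> reg d 6 = n - Suc j \<and> mem d = M" for d
      using Suc.hyps(1)[of "Suc j" d] Suc.hyps(2) that j by simp
  qed (use j in auto)
qed

definition based :: "nat \<Rightarrow> config \<Rightarrow> bool" where
  "based l c \<longleftrightarrow> base l c \<and> reg c 8 = L \<and> reg c 9 = L + n"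

lemma words_le_bounds: "words_le b c \<Longrightarrow> reg c r \<le> b" "words_le b c \<Longrightarrow> mem c a \<le> b"
  by (simp_all add: words_le_def)

lemma address_bounds: "L \<le> b" "n \<le> b" "L + n \<le> b" "L - Suc 0 \<le> b" "L - Suc n \<le> b" "1 \<le> b" "Suc 0 \<le> b"
 "n - x \<le> b"
  using bound by auto

lemma index_bounds:
  assumes "x < n"
  shows "L + x \<le> b" "L + n + x \<le> b" "Suc (L + n + x) \<le> b" "Suc (L + x) \<le> b" "Suc x \<le> b" "x \<le> b"
  using bound assms by auto

text \<open>The input consists of \<open>n\<close>, the \<open>n\<close> degrees and one word per
  arc, so \<open>L - Suc n\<close> is the number of arcs.\<close>

lemma prepare_division:
  assumes "base 11 c" "reg c 5 = L" "mem c = M"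
  shows "reaches program b 5 c (\<lambda>c. based 16 c \<and> reg c 0 = n \<and> reg c 10 = L - Suc n \<and> mem c = M)"
  by (rule reachesI[of _ _ 5])
    (use assms address_bounds in \<open>simp_all add: exec_simps base_def based_def\<close>)

lemma divide_by_4:
  assumes "based 16 c" "reg c 0 = x" "reg c 10 = 4 * a" "x + a \<le> b" "mem c = M"
  shows "reaches program b (4 * a + 1) c (\<lambda>c. based 20 c \<and> reg c 0 = x + a \<and> mem c = M)"
  using assms
proof (induction a arbitrary: x c)
  case 0
  then show ?case by (intro reachesI[of _ _ 1]) (simp_all add: exec_simps base_def based_def)
next
  case (Suc a)
  have "4 * a \<le> b"
    using Suc.prems(1,3) words_le_bounds(1)[of c 10] by (simp add: based_def base_def)
  note facts = Suc.prems(1-3,5)[unfolded based_def base_def] this Suc.prems(4)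
  show ?case
  proof (rule reaches_trans_le)
    show "reaches program b 4 c
      (\<lambda>c. based 16 c \<and> reg c 0 = Suc x \<and> reg c 10 = 4 * a \<and> mem c = M)"
      by (rule reachesI[of _ _ 4]) (use facts in \<open>simp_all add: exec_simps base_def based_def\<close>)
    show "reaches program b (4 * a + 1) d (\<lambda>c. based 20 c \<and> reg c 0 = x + Suc a \<and> mem c = M)"
      if "based 16 d \<and> reg d 0 = Suc x \<and> reg d 10 = 4 * a \<and> mem d = M" for d
      using Suc.IH[of d "Suc x"] Suc.prems(4) that by simp
  qed simp
qed

text \<open>The tables occupy addresses from \<open>L\<close> on, so the input stays intact while it
  is still being read.\<close>

definition filled :: "nat \<Rightarrow> (nat \<Rightarrow> nat) \<Rightarrow> bool" where
  "filled j m \<longleftrightarrow> (\<forall>a<L. m a = M a) \<and>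
     (\<forall>i<j. m (L + i) = length (adj ! i) \<and> m (L + n + i) = sum_list (adj ! i))"

lemma prepare_fill:
  assumes "based 20 c" "reg c 0 = g" "mem c = M"
  shows "reaches program b 4 c (\<lambda>c. based 24 c \<and> reg c 0 = g \<and> reg c 5 = offset adj 0 \<and>
    reg c 6 = n \<and> reg c 11 = L \<and> reg c 12 = L + n \<and> filled 0 (mem c))"
  by (rule reachesI[of _ _ 4])
    (use assms address_bounds in \<open>simp_all add: exec_simps base_def based_def filled_def offset_def\<close>)

text \<open>Distinct neighbours below \<open>n\<close> sum to at most \<open>n * n\<close>. Prefixes
  are covered because every partial sum occurs as a word.\<close>

lemma sum_list_take_le:
  assumes "j < n"
  shows "sum_list (take i (adj ! j)) \<le> b"
proof -
  have "sum_list (take i (adj ! j)) = (\<Sum>x\<in>set (take i (adj ! j)). x)"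
    using distinct_adj[OF assms] by (simp add: sum.distinct_set_conv_list)
  also have "\<dots> \<le> (\<Sum>x\<in>{..<n}. x)"
    using adj_less[OF assms] set_take_subset[of i "adj ! j"] by (intro sum_mono2) auto
  also have "\<dots> \<le> (\<Sum>x\<in>{..<n}. n)" by (rule sum_mono) simp
  also have "\<dots> \<le> b" using bound(2) by simp
  finally show ?thesis .
qed

lemma offset_Suc_le_L: "j < n \<Longrightarrow> offset adj (Suc j) \<le> L"
  unfolding L_def by (rule offset_mono) simp

lemma sum_row:
  assumes j: "j < n" and m: "\<And>a. a < L \<Longrightarrow> m a = M a"
    and "based 29 c" "reg c 0 = g" "reg c 5 = Suc (offset adj j + i)" "reg c 6 = n - j"
    "reg c 7 = length (adj ! j) - i" "reg c 11 = p" "reg c 12 = r"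
    "reg c 13 = sum_list (take i (adj ! j))" "mem c = m" "i \<le> length (adj ! j)"
  shows "reaches program b (6 * (length (adj ! j) - i) + 1) c (\<lambda>c. based 35 c \<and> reg c 0 = g \<and>
    reg c 5 = offset adj (Suc j) \<and> reg c 6 = n - j \<and> reg c 11 = p \<and> reg c 12 = r \<and>
    reg c 13 = sum_list (adj ! j) \<and> mem c = m)"
  using assms(3-)
proof (induction "length (adj ! j) - i" arbitrary: i c)
  case 0
  then show ?case
    by (intro reachesI[of _ _ 1]) (simp_all add: exec_simps base_def based_def offset_Suc)
next
  case (Suc l)
  have i: "i < length (adj ! j)" using Suc.hyps(2) by simp
  have less: "Suc (offset adj j + i) < L" using offset_Suc_le_L[OF j] i by (simp add: offset_Suc)
  then have mi: "m (Suc (offset adj j + i)) = adj ! j ! i" using m M_neighbour[OF j i] by simp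
  have take: "sum_list (take i (adj ! j)) + adj ! j ! i = sum_list (take (Suc i) (adj ! j))"
    using i by (simp add: take_Suc_conv_app_nth)
  have le: "sum_list (take (Suc i) (adj ! j)) \<le> b" "adj ! j ! i \<le> b"
    "Suc (Suc (offset adj j + i)) \<le> b" "length (adj ! j) - Suc i \<le> b"
    using sum_list_take_le[OF j, of "Suc i"] adj_less[OF j, of "adj ! j ! i"] i less address_bounds(1,2)
      degree_le[OF j] by auto
  note facts = Suc.prems[unfolded based_def base_def] mi take le i
  let ?Q = "\<lambda>c. based 29 c \<and> reg c 0 = g \<and> reg c 5 = Suc (offset adj j + Suc i) \<and> reg c 6 = n - j \<and>
    reg c 7 = length (adj ! j) - Suc i \<and> reg c 11 = p \<and> reg c 12 = r \<and>
    reg c 13 = sum_list (take (Suc i) (adj ! j)) \<and> mem c = m"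
  show ?case
  proof (rule reaches_trans_le)
    show "reaches program b 6 c ?Q"
      by (rule reachesI[of _ _ 6]) (use facts in \<open>simp_all add: exec_simps base_def based_def\<close>)
  next
    fix d assume "?Q d"
    then show "reaches program b (6 * (length (adj ! j) - Suc i) + 1) d (\<lambda>c. based 35 c \<and> reg c 0 = g \<and>
      reg c 5 = offset adj (Suc j) \<and> reg c 6 = n - j \<and> reg c 11 = p \<and> reg c 12 = r \<and>
      reg c 13 = sum_list (adj ! j) \<and> mem c = m)"
      using Suc.hyps(1)[of "Suc i" d] Suc.hyps(2) i by simp
  qed (use i in auto)
qed

text \<open>A row with \<open>d\<close> neighbours costs at most \<open>6 * d + 11\<close> steps;
  rounding up to 11 per input word lets the rows telescope along \<open>offset adj\<close>.\<close>

lemma fill_row: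
  assumes j: "j < n" and c: "based 24 c" "reg c 0 = g" "reg c 5 = offset adj j" "reg c 6 = n - j"
    "reg c 11 = L + j" "reg c 12 = L + n + j" and filled: "filled j (mem c)"
  shows "reaches program b (11 * Suc (length (adj ! j))) c (\<lambda>c. based 24 c \<and> reg c 0 = g \<and>
    reg c 5 = offset adj (Suc j) \<and> reg c 6 = n - Suc j \<and> reg c 11 = L + Suc j \<and>
    reg c 12 = L + n + Suc j \<and> filled (Suc j) (mem c))"
proof -
  define m where "m = (mem c)(L + j := length (adj ! j))"
  have m: "a < L \<Longrightarrow> m a = M a" for a using filled by (simp add: filled_def m_def)
  have less: "offset adj j < L" using offset_Suc_le_L[OF j] by (simp add: offset_Suc)
  then have row: "mem c (offset adj j) = length (adj ! j)"
    using filled M_degree[OF j] by (simp add: filled_def)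
  have le: "length (adj ! j) \<le> b" "Suc (offset adj j) \<le> b" "n - Suc j \<le> b"
    using degree_le[OF j] address_bounds(1,2) less by auto
  let ?Q1 = "\<lambda>c. based 29 c \<and> reg c 0 = g \<and> reg c 5 = Suc (offset adj j + 0) \<and> reg c 6 = n - j \<and>
    reg c 7 = length (adj ! j) - 0 \<and> reg c 11 = L + j \<and> reg c 12 = L + n + j \<and>
    reg c 13 = sum_list (take 0 (adj ! j)) \<and> mem c = m"
  let ?Q2 = "\<lambda>c. based 35 c \<and> reg c 0 = g \<and>
    reg c 5 = offset adj (Suc j) \<and> reg c 6 = n - j \<and> reg c 11 = L + j \<and> reg c 12 = L + n + j \<and>
    reg c 13 = sum_list (adj ! j) \<and> mem c = m"
  have 1: "reaches program b 5 c ?Q1"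
    by (rule reachesI[of _ _ 5])
      (use c row le j address_bounds in \<open>simp_all add: exec_simps base_def based_def m_def\<close>)
  have 2: "reaches program b (6 * length (adj ! j) + 1) d ?Q2" if "?Q1 d" for d
    using sum_row[OF j m, of d g 0 "L + j" "L + n + j"] that by simp
  have 3: "reaches program b 5 d (\<lambda>c. based 24 c \<and> reg c 0 = g \<and>
    reg c 5 = offset adj (Suc j) \<and> reg c 6 = n - Suc j \<and> reg c 11 = L + Suc j \<and>
    reg c 12 = L + n + Suc j \<and> filled (Suc j) (mem c))" if d: "?Q2 d" for d
  proof -
    have "filled (Suc j) (m(L + n + j := sum_list (adj ! j)))"
      using filled j by (auto simp: filled_def less_Suc_eq m_def)
    moreover have "sum_list (adj ! j) \<le> b" using sum_list_take_le[OF j, of "length (adj ! j)"] by simp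
    ultimately show ?thesis
      by (intro reachesI[of _ _ 5])
        (use d le j address_bounds(1-7) index_bounds[OF j] in \<open>simp_all add: exec_simps base_def based_def\<close>)
  qed
  show ?thesis
    by (rule reaches_trans_le[OF reaches_trans[OF 1 2] 3]) auto
qed

lemma fill:
  assumes "based 24 c" "reg c 0 = g" "reg c 5 = offset adj j" "reg c 6 = n - j"
    "reg c 11 = L + j" "reg c 12 = L + n + j" "filled j (mem c)" "j \<le> n"
  shows "reaches program b (11 * (L - offset adj j) + 1) c
    (\<lambda>c. based 40 c \<and> reg c 0 = g \<and> filled n (mem c))"
  using assms
proof (induction "n - j" arbitrary: j c)
  case 0
  then show ?case
    by (intro reachesI[of _ _ 1]) (simp_all add: exec_simps base_def based_def)
next
  case (Suc l)
  have j: "j < n" using Suc.hyps(2) by simp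
  show ?case
  proof (rule reaches_trans_le[OF fill_row[OF j Suc.prems(1-7)]])
    show "reaches program b (11 * (L - offset adj (Suc j)) + 1) d
        (\<lambda>c. based 40 c \<and> reg c 0 = g \<and> filled n (mem c))"
      if "based 24 d \<and> reg d 0 = g \<and> reg d 5 = offset adj (Suc j) \<and> reg d 6 = n - Suc j \<and>
        reg d 11 = L + Suc j \<and> reg d 12 = L + n + Suc j \<and> filled (Suc j) (mem d)" for d
      using Suc.hyps(1)[of "Suc j" d] Suc.hyps(2) that j by simp
  qed (use offset_Suc_le_L[OF j] in \<open>simp add: offset_Suc\<close>)
qed

section \<open>Stripping the leaves\<close>

definition admissible :: "(nat \<times> nat) set \<Rightarrow> bool" where
  "admissible A \<longleftrightarrow> A \<subseteq> {..<n} \<times> {..<n} \<and> sym A \<and> irrefl A"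

text \<open>The sum at an isolated vertex is left open: deleting the edge at a leaf clears the
  degree of the leaf but leaves its sum stale.\<close>

definition tabulated :: "(nat \<times> nat) set \<Rightarrow> (nat \<Rightarrow> nat) \<Rightarrow> bool" where
  "tabulated A m \<longleftrightarrow> (\<forall>x<n. m (L + x) = card (A `` {x}) \<and>
     (A `` {x} \<noteq> {} \<longrightarrow> m (L + n + x) = \<Sum>(A `` {x})))"

text \<open>The loop invariant: the accumulator exceeds the rank of the remaining graph by a
  constant \<open>y\<close>, which is the final result.\<close>

definition peeling :: "nat \<Rightarrow> (nat \<times> nat) set \<Rightarrow> config \<Rightarrow> bool" where
  "peeling y A c \<longleftrightarrow> admissible A \<and> tabulated A (mem c) \<and> reg c 0 = y + orient_rank A"

lemma admissible_finite: "admissible A \<Longrightarrow> finite A"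
  unfolding admissible_def by (meson finite_SigmaI finite_lessThan finite_subset)

lemma remove_leaf:
  assumes A: "admissible A" "tabulated A m" and leaf: "A `` {u} = {w}"
    and m': "m' = m(L + u := 0, L + w := m (L + w) - 1, L + n + w := m (L + n + w) - u)"
    and A': "A' = A - {(u, w), (w, u)}"
  shows "admissible A'" "tabulated A' m'" "card A = Suc (Suc (card A'))"
    "orient_rank A = Suc (orient_rank A')" "A' `` {x} = (if x = u then {} else if x = w then A `` {w} - {u} else A `` {x})"
proof -
  have fin: "finite A" using admissible_finite[OF A(1)] .
  have uw: "(u, w) \<in> A" "(w, u) \<in> A" "u \<noteq> w" "u < n" "w < n"
    using leaf A(1) by (auto simp: admissible_def sym_def irrefl_def)
  have img: "A' `` {x} = (if x = u then {} else if x = w then A `` {w} - {u} else A `` {x})" for x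
    using leaf uw(3) by (auto simp: A')
  show "A' `` {x} = (if x = u then {} else if x = w then A `` {w} - {u} else A `` {x})"
    by (rule img)
  show "admissible A'" using A(1) by (auto simp: admissible_def A' sym_def irrefl_def)
  show "orient_rank A = Suc (orient_rank A')"
    unfolding A' by (rule orient_rank_leaf) (use fin A(1) leaf in \<open>auto simp: admissible_def\<close>)
  have "card (A - {(u, w), (w, u)}) = card A - card {(u, w), (w, u)}"
    by (rule card_Diff_subset) (use uw in auto)
  moreover have "card {(u, w), (w, u)} \<le> card A" by (rule card_mono) (use fin uw in auto)
  ultimately show "card A = Suc (Suc (card A'))" using uw(3) by (simp add: A')
  show "tabulated A' m'"
    unfolding tabulated_def
  proof (intro allI impI)
    fix x assume x: "x < n"
    have mx: "m (L + x) = card (A `` {x})" "A `` {x} \<noteq> {} \<Longrightarrow> m (L + n + x) = \<Sum>(A `` {x})"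
      using A(2) x by (simp_all add: tabulated_def)
    consider "x = u" | "x = w" "x \<noteq> u" | "x \<noteq> u" "x \<noteq> w" by blast
    then show "m' (L + x) = card (A' `` {x}) \<and> (A' `` {x} \<noteq> {} \<longrightarrow> m' (L + n + x) = \<Sum>(A' `` {x}))"
    proof cases
      case 1
      then show ?thesis unfolding img using uw by (simp add: m')
    next
      case 2
      have "finite (A `` {w})" "u \<in> A `` {w}" using fin uw by auto
      then have "card (A `` {w} - {u}) = card (A `` {w}) - 1" "\<Sum>(A `` {w} - {u}) = \<Sum>(A `` {w}) - u"
        "A `` {w} \<noteq> {}"
        by (auto simp: sum_diff1_nat)
      then show ?thesis unfolding img using uw 2 mx by (simp add: m')
    next
      case 3
      then show ?thesis unfolding img using uw x mx by (simp add: m')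
    qed
  qed
qed

lemma peel_leaf:
  assumes c: "based 44 c" "reg c 5 = v" "reg c 6 = r" "reg c 11 = u" "u < n" "peeling y A c"
    and leaf: "A `` {u} = {w}"
  shows "reaches program b 19 c (\<lambda>c. based 44 c \<and> reg c 5 = v \<and> reg c 6 = r \<and> reg c 11 = w \<and>
    peeling y (A - {(u, w), (w, u)}) c)"
proof -
  define m where "m = mem c"
  define m' where "m' = m(L + u := 0, L + w := m (L + w) - 1, L + n + w := m (L + n + w) - u)"
  define A' where "A' = A - {(u, w), (w, u)}"
  have A: "admissible A" "tabulated A m" "reg c 0 = y + orient_rank A"
    using c(6) by (simp_all add: peeling_def m_def)
  note rl = remove_leaf[OF A(1,2) leaf m'_def A'_def]
  have uw: "(u, w) \<in> A" "u \<noteq> w" "w < n" using leaf A(1) by (auto simp: admissible_def irrefl_def)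
  have m: "m (L + u) = 1" "m (L + n + u) = w"
    using A(2) c(5) leaf by (simp_all add: tabulated_def)
  have ne: "L + u \<noteq> L + w" "L + n + w \<noteq> L + u" "L + n + w \<noteq> L + w" using uw c(5) by simp_all
  have "words_le b c" using c(1) by (simp add: based_def base_def)
  then have mb: "m a \<le> b" "m a - l \<le> b" "y + orient_rank A' \<le> b" "y + orient_rank A \<le> b" for a l
    using words_le_bounds(1)[of c 0] words_le_bounds(2)[of c a] A(3) rl(4) by (simp_all add: m_def)
  \<comment> \<open>The accumulator is a successor, so the truncated subtraction of 1 is
    exact.\<close>
  have g: "reg c 0 = Suc (y + orient_rank A')" using A(3) rl(4) by simp
  note facts = c(1-4)[unfolded based_def base_def] g m uw(2,3) c(5) ne mb
    address_bounds(1-7) index_bounds[OF c(5)] index_bounds[OF uw(3)] m_def[symmetric]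
  have run: "bounded_run program b 19 c" "based 44 ((step program ^^ 19) c)"
    "reg ((step program ^^ 19) c) 5 = v" "reg ((step program ^^ 19) c) 6 = r"
    "reg ((step program ^^ 19) c) 11 = w" "mem ((step program ^^ 19) c) = m'"
    "reg ((step program ^^ 19) c) 0 = y + orient_rank A'"
    using facts by (simp_all add: exec_simps based_def base_def m'_def)
  show ?thesis
    by (rule reachesI[of _ _ 19]) (use run rl(1,2) in \<open>simp_all add: peeling_def A'_def\<close>)
qed

lemma skip_vertex:
  assumes c: "based 44 c" "reg c 5 = v" "reg c 6 = r" "reg c 11 = u" "u < n" "v < n" "peeling y A c"
    and no_leaf: "card (A `` {u}) \<noteq> 1"
  shows "reaches program b 9 c (\<lambda>c. based 42 c \<and> reg c 5 = Suc v \<and> reg c 6 = r - 1 \<and> peeling y A c)"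
proof -
  define m where "m = mem c"
  define d where "d = card (A `` {u})"
  have A: "admissible A" "tabulated A m" "reg c 0 = y + orient_rank A"
    using c(7) by (simp_all add: peeling_def m_def)
  have m: "m (L + u) = d" using A(2) c(5) by (simp add: tabulated_def d_def)
  have w: "words_le b c" using c(1) by (simp add: based_def base_def)
  then have mb: "d \<le> b" "d - l \<le> b" "r \<le> b" "r - l \<le> b" for l
    using words_le_bounds(2)[of c "L + u"] words_le_bounds(1)[of c 6] m c(3) by (simp_all add: m_def)
  note facts = c(1-4)[unfolded based_def base_def] m c(5) mb
    address_bounds(1-7) index_bounds[OF c(5)] index_bounds[OF c(6)] m_def[symmetric]
  show ?thesis
  \<comment> \<open>The program tests for degree 0 before it decrements; truncation would otherwise
    make degree 0 look like degree 1.\<close>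
  proof (cases "d = 0")
    case True
    have run: "bounded_run program b 6 c" "based 42 ((step program ^^ 6) c)"
      "reg ((step program ^^ 6) c) 5 = Suc v" "reg ((step program ^^ 6) c) 6 = r - 1"
      "mem ((step program ^^ 6) c) = m" "reg ((step program ^^ 6) c) 0 = reg c 0"
      using facts True by (simp_all add: exec_simps based_def base_def)
    show ?thesis
      by (rule reachesI[of _ _ 6]) (use run A in \<open>simp_all add: peeling_def\<close>)
  next
    case False
    then have "1 < d" using no_leaf by (simp add: d_def)
    then have run: "bounded_run program b 9 c" "based 42 ((step program ^^ 9) c)"
      "reg ((step program ^^ 9) c) 5 = Suc v" "reg ((step program ^^ 9) c) 6 = r - 1"
      "mem ((step program ^^ 9) c) = m" "reg ((step program ^^ 9) c) 0 = reg c 0"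
      using facts by (simp_all add: exec_simps based_def base_def)
    show ?thesis
      by (rule reachesI[of _ _ 9]) (use run A in \<open>simp_all add: peeling_def\<close>)
  qed
qed

definition peeled :: "nat \<Rightarrow> config \<Rightarrow> bool" where
  "peeled y c \<longleftrightarrow> based 67 c \<and> (\<exists>A. peeling y A c \<and> (\<forall>x. card (A `` {x}) \<noteq> 1))"

lemma no_leaf_outside: "admissible A \<Longrightarrow> n \<le> x \<Longrightarrow> card (A `` {x}) \<noteq> 1"
proof -
  assume "admissible A" "n \<le> x"
  then have "A `` {x} = {}" by (auto simp: admissible_def)
  then show ?thesis by simp
qed

lemma next_vertex:
  assumes "based 42 c" "reg c 5 = v" "reg c 6 = n - v" "v < n" "peeling y A c"
  shows "reaches program b 2 c (\<lambda>c. based 44 c \<and> reg c 5 = v \<and> reg c 6 = n - v \<and> reg c 11 = v \<and>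
    peeling y A c)"
  by (rule reachesI[of _ _ 2])
    (use assms address_bounds in \<open>simp_all add: exec_simps base_def based_def peeling_def\<close>)

lemma last_vertex:
  assumes "based 42 c" "reg c 6 = 0" "peeling y A c" "\<And>x. x < n \<Longrightarrow> card (A `` {x}) \<noteq> 1"
  shows "reaches program b 1 c (peeled y)"
proof -
  have run: "bounded_run program b 1 c" "based 67 ((step program ^^ 1) c)"
      "mem ((step program ^^ 1) c) = mem c" "reg ((step program ^^ 1) c) 0 = reg c 0"
    using assms(1,2) by (simp_all add: exec_simps based_def base_def)
  have A: "admissible A" using assms(3) by (simp add: peeling_def)
  have "card (A `` {x}) \<noteq> 1" for x
    using assms(4) no_leaf_outside[OF A] by (cases "x < n") auto
  then have "peeled y ((step program ^^ 1) c)"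
    using run(2-) assms(3) unfolding peeled_def peeling_def by auto
  then show ?thesis using run(1) by (intro reachesI[of _ _ 1]) auto
qed

text \<open>Among the vertices up to \<open>v\<close>, only the current \<open>u\<close> can be a
  leaf. Deleting its edge isolates \<open>u\<close> and lowers only the degree of its neighbour,
  which becomes the next candidate even if the scan has passed it. A deletion takes 19 steps and
  removes two arcs, worth 40 in the bound; moving on takes \<open>9 + 2\<close> steps, paid by the
  vertex.\<close>

lemma peel_from:
  assumes "based 44 c" "reg c 5 = v" "reg c 6 = n - v" "reg c 11 = u" "u < n" "v < n" "peeling y A c"
    "\<And>x. x \<le> v \<Longrightarrow> card (A `` {x}) = 1 \<Longrightarrow> x = u"
  shows "reaches program b (20 * card A + 11 * (n - v)) c (peeled y)"
  using assms
proof (induction "card A + (n - v)" arbitrary: A c u v rule: less_induct)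
  case less
  note prems = less.prems
  have A: "admissible A" using prems(7) by (simp add: peeling_def)
  show ?case
  proof (cases "card (A `` {u}) = 1")
    case True
    then obtain w where w: "A `` {u} = {w}" by (rule card_1_singletonE)
    define A' where "A' = A - {(u, w), (w, u)}"
    have tab: "tabulated A (mem c)" using prems(7) by (simp add: peeling_def)
    note rl = remove_leaf[OF A tab w refl A'_def]
    have wn: "w < n" using w A by (auto simp: admissible_def)
    have uniq: "x = w" if "x \<le> v" "card (A' `` {x}) = 1" for x
      using that prems(8)[of x] rl(5)[of x] by (auto split: if_splits)
    show ?thesis
    proof (rule reaches_trans_le[OF peel_leaf[OF prems(1-5,7) w]])
      fix d assume d: "based 44 d \<and> reg d 5 = v \<and> reg d 6 = n - v \<and> reg d 11 = w \<and>
        peeling y (A - {(u, w), (w, u)}) d"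
      show "reaches program b (20 * card A' + 11 * (n - v)) d (peeled y)"
      proof (rule less.hyps)
        show "card A' + (n - v) < card A + (n - v)" using rl(3) by simp
        show "peeling y A' d" using d by (simp add: A'_def)
      qed (use d wn prems(6) uniq in blast)+
    qed (use rl(3) in simp)
  next
    case False
    then have none: "card (A `` {x}) \<noteq> 1" if "x \<le> v" for x using prems(8)[of x] that by auto
    show ?thesis
    proof (rule reaches_trans_le[OF skip_vertex[OF prems(1-7) False]])
      fix d assume d: "based 42 d \<and> reg d 5 = Suc v \<and> reg d 6 = n - v - 1 \<and> peeling y A d"
      show "reaches program b (20 * card A + 11 * (n - v) - 9) d (peeled y)"
      proof (cases "Suc v < n")
        case True
        show ?thesis
        proof (rule reaches_trans_le[OF next_vertex[of d "Suc v" y A]])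
          fix d' assume "based 44 d' \<and> reg d' 5 = Suc v \<and> reg d' 6 = n - Suc v \<and> reg d' 11 = Suc v \<and>
            peeling y A d'"
          then show "reaches program b (20 * card A + 11 * (n - Suc v)) d' (peeled y)"
          proof (intro less.hyps)
            show "card A + (n - Suc v) < card A + (n - v)" using True by simp
            show "x = Suc v" if "x \<le> Suc v" "card (A `` {x}) = 1" for x
              using that none[of x] by (auto simp: le_Suc_eq)
          qed (use True in blast)+
        qed (use d True in auto)
      next
        case False
        then have "reaches program b 1 d (peeled y)"
          using d none prems(6) by (intro last_vertex[of d y A]) auto
        then show ?thesis by (rule reaches_mono) (use prems(6) in auto)
      qed
    qed (use prems(6) in auto)
  qed
qed

lemma peel:
  assumes "based 40 c" "peeling y A c"
  shows "reaches program b (20 * card A + 11 * n + 5) c (peeled y)"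
proof -
  have 1: "reaches program b 2 c (\<lambda>c. based 42 c \<and> reg c 5 = 0 \<and> reg c 6 = n \<and> peeling y A c)"
    by (rule reachesI[of _ _ 2])
      (use assms address_bounds in \<open>simp_all add: exec_simps base_def based_def peeling_def\<close>)
  have 2: "reaches program b (20 * card A + 11 * n + 3) d (peeled y)"
    if d: "based 42 d \<and> reg d 5 = 0 \<and> reg d 6 = n \<and> peeling y A d" for d
  proof (cases "0 < n")
    case True
    show ?thesis
    proof (rule reaches_trans_le[OF next_vertex[of d 0 y A]])
      show "reaches program b (20 * card A + 11 * (n - 0)) d' (peeled y)"
        if "based 44 d' \<and> reg d' 5 = 0 \<and> reg d' 6 = n - 0 \<and> reg d' 11 = 0 \<and> peeling y A d'" for d'
        using that True by (intro peel_from) auto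
    qed (use d True in auto)
  next
    case False
    then have "reaches program b 1 d (peeled y)"
      using d by (intro last_vertex[of d y A]) auto
    then show ?thesis by (rule reaches_mono) simp
  qed
  show ?thesis by (rule reaches_trans_le[OF 1 2]) auto
qed

section \<open>Subtracting the rank of what remains\<close>

lemma count_from:
  assumes "based 69 c" "reg c 5 = L + j" "reg c 6 = n - j" "j \<le> n" "tabulated A (mem c)"
    "reg c 0 = y + card {x \<in> {j..<n}. A `` {x} \<noteq> {}}" "finite A"
  shows "reaches program b (7 * (n - j) + 1) c (\<lambda>c. pc c = 76 \<and> reg c 0 = y)"
  using assms
proof (induction "n - j" arbitrary: j c)
  case 0
  then show ?case
    by (intro reachesI[of _ _ 1]) (simp_all add: exec_simps base_def based_def)
next
  case (Suc l)
  have j: "j < n" using Suc.hyps(2) by simp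
  define d where "d = card (A `` {j})"
  have m: "mem c (L + j) = d" using Suc.prems(5) j by (simp add: tabulated_def d_def)
  have d0: "d = 0 \<longleftrightarrow> A `` {j} = {}" using Suc.prems(7) by (simp add: d_def)
  have split: "{x \<in> {j..<n}. A `` {x} \<noteq> {}} =
    (if d = 0 then {} else {j}) \<union> {x \<in> {Suc j..<n}. A `` {x} \<noteq> {}}"
  proof -
    have "{j..<n} = insert j {Suc j..<n}" using j by auto
    then show ?thesis using d0 by auto
  qed
  define K where "K = card {x \<in> {Suc j..<n}. A `` {x} \<noteq> {}}"
  have K: "card {x \<in> {j..<n}. A `` {x} \<noteq> {}} = (if d = 0 then K else Suc K)"
    unfolding split by (simp add: K_def)
  have "words_le b c" using Suc.prems(1) by (simp add: based_def base_def)
  then have mb: "d \<le> b" "y + (if d = 0 then K else Suc K) \<le> b"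
    using words_le_bounds(2)[of c "L + j"] words_le_bounds(1)[of c 0] m Suc.prems(6) K by simp_all
  note facts = Suc.prems(1-3)[unfolded based_def base_def] Suc.prems(5) Suc.prems(6)[unfolded K] m mb j
    address_bounds(1-7) index_bounds[OF j]
  let ?Q = "\<lambda>c. based 69 c \<and> reg c 5 = L + Suc j \<and> reg c 6 = n - Suc j \<and> tabulated A (mem c) \<and>
    reg c 0 = y + K"
  have 1: "reaches program b 7 c ?Q"
  proof (cases "d = 0")
    case True
    show ?thesis
      by (rule reachesI[of _ _ 6])
        (use facts True in \<open>simp_all add: exec_simps base_def based_def\<close>)
  next
    case False
    show ?thesis
      by (rule reachesI[of _ _ 7])
        (use facts False in \<open>simp_all add: exec_simps base_def based_def\<close>)
  qed
  show ?case
  proof (rule reaches_trans_le[OF 1])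
    show "reaches program b (7 * (n - Suc j) + 1) d' (\<lambda>c. pc c = 76 \<and> reg c 0 = y)" if "?Q d'" for d'
      using Suc.hyps(1)[of "Suc j" d'] Suc.hyps(2) that j Suc.prems(7) by (simp add: K_def)
  qed (use j in auto)
qed

text \<open>Without leaves the remaining rank is the number of nonisolated vertices, so one
  subtraction per nonzero degree brings the accumulator down to \<open>y\<close>.\<close>

lemma count:
  assumes "peeled y c"
  shows "reaches program b (7 * n + 3) c (\<lambda>c. pc c = 76 \<and> reg c 0 = y)"
proof -
  obtain A where c: "based 67 c" and A: "peeling y A c" "\<And>x. card (A `` {x}) \<noteq> 1"
    using assms by (auto simp: peeled_def)
  have adm: "admissible A" "finite A" using A(1) admissible_finite by (auto simp: peeling_def)
  then have "orient_rank A = card (Domain A)"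
    using A(2) by (intro orient_rank_no_leaf) (auto simp: admissible_def)
  moreover have "Domain A = {x \<in> {0..<n}. A `` {x} \<noteq> {}}"
    using adm by (auto simp: admissible_def)
  ultimately have r: "reg c 0 = y + card {x \<in> {0..<n}. A `` {x} \<noteq> {}}" "tabulated A (mem c)"
    using A(1) by (simp_all add: peeling_def)
  have 1: "reaches program b 2 c (\<lambda>c. based 69 c \<and> reg c 5 = L + 0 \<and> reg c 6 = n - 0 \<and>
    tabulated A (mem c) \<and> reg c 0 = y + card {x \<in> {0..<n}. A `` {x} \<noteq> {}})"
    by (rule reachesI[of _ _ 2])
      (use c r address_bounds in \<open>simp_all add: exec_simps base_def based_def\<close>)
  show ?thesis
  proof (rule reaches_trans_le[OF 1])
    show "reaches program b (7 * n + 1) d (\<lambda>c. pc c = 76 \<and> reg c 0 = y)"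
      if "based 69 d \<and> reg d 5 = L + 0 \<and> reg d 6 = n - 0 \<and>
        tabulated A (mem d) \<and> reg d 0 = y + card {x \<in> {0..<n}. A `` {x} \<noteq> {}}" for d
      using count_from[of d 0 A y] that adm(2) by simp
  qed simp
qed

end

text \<open>Stands outside the locale because it helps to establish the word bound that the locale
  assumes.\<close>

lemma offset_length:
  assumes "\<And>i. i < length adj \<Longrightarrow> distinct (adj ! i)"
  shows "offset adj (length adj) = Suc (length adj + card (SIGMA i:{..<length adj}. set (adj ! i)))"
  using assms by (simp add: offset_def sum_Suc distinct_card)

section \<open>Assembly of the run and its bounds\<close>

context adjacency_input
begin

definition arc_set :: "(nat \<times> nat) set" where
  "arc_set = (SIGMA i:{..<n}. set (adj ! i))"

lemma L_eq: "L = Suc (n + card arc_set)"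
  using distinct_adj by (simp add: L_def arc_set_def n_def offset_length)

lemma tabulated_filled:
  assumes "filled n m"
  shows "tabulated arc_set m"
  unfolding tabulated_def
proof (intro allI impI)
  fix x assume x: "x < n"
  then have "arc_set `` {x} = set (adj ! x)" by (auto simp: arc_set_def)
  moreover have "\<Sum>(set (adj ! x)) = sum_list (adj ! x)"
    using distinct_adj[OF x] sum.distinct_set_conv_list[of "adj ! x" "\<lambda>x. x"] by simp
  ultimately show "m (L + x) = card (arc_set `` {x}) \<and>
      (arc_set `` {x} \<noteq> {} \<longrightarrow> m (L + n + x) = \<Sum>(arc_set `` {x}))"
    using assms x distinct_adj[OF x] by (simp add: filled_def distinct_card)
qed

text \<open>The coefficients add up over the segments. Per vertex: 6 for measuring, 11 for filling,
  11 for stripping, 7 for counting. Per arc: 1 for the division, 11 for filling, 20 for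
  stripping.\<close>

lemma program_correct:
  assumes "sym arc_set" "irrefl arc_set" and dvd: "4 dvd card arc_set"
    and y: "y + orient_rank arc_set = n + card arc_set div 4"
  shows "reaches program b (35 * n + 32 * card arc_set + 25) (init_config (encode adj))
    (\<lambda>c. pc c = 76 \<and> reg c 0 = y)"
proof -
  let ?c = "init_config (encode adj)" and ?a = "card arc_set div 4"
  have adm: "admissible arc_set"
    using assms(1,2) adj_less by (auto simp: admissible_def arc_set_def)
  have a: "L - Suc n = 4 * ?a" "n + ?a \<le> b" "L - 1 = n + card arc_set"
    using dvd L_eq address_bounds(1) by auto
  have "reaches program b (5 + (6 * n + 1)) ?c (\<lambda>c. base 11 c \<and> reg c 5 = L \<and> mem c = M)"
    by (rule reaches_trans[OF start]) (use measure_input[of _ 0] in auto)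
  then have "reaches program b (5 + (6 * n + 1) + 5) ?c
      (\<lambda>c. based 16 c \<and> reg c 0 = n \<and> reg c 10 = 4 * ?a \<and> mem c = M)"
    by (rule reaches_trans) (use prepare_division a in auto)
  then have "reaches program b (5 + (6 * n + 1) + 5 + (4 * ?a + 1)) ?c
      (\<lambda>c. based 20 c \<and> reg c 0 = n + ?a \<and> mem c = M)"
    by (rule reaches_trans) (use divide_by_4[of _ n ?a] a in auto)
  then have "reaches program b (5 + (6 * n + 1) + 5 + (4 * ?a + 1) + 4) ?c
      (\<lambda>c. based 24 c \<and> reg c 0 = n + ?a \<and> reg c 5 = offset adj 0 \<and>
        reg c 6 = n \<and> reg c 11 = L \<and> reg c 12 = L + n \<and> filled 0 (mem c))"
    by (rule reaches_trans) (use prepare_fill in auto)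
  then have "reaches program b (5 + (6 * n + 1) + 5 + (4 * ?a + 1) + 4 + (11 * (L - 1) + 1)) ?c
      (\<lambda>c. based 40 c \<and> reg c 0 = n + ?a \<and> filled n (mem c))"
    by (rule reaches_trans) (use fill[of _ "n + ?a" 0] in \<open>auto simp: offset_def\<close>)
  then have "reaches program b (5 + (6 * n + 1) + 5 + (4 * ?a + 1) + 4 + (11 * (L - 1) + 1) +
      (20 * card arc_set + 11 * n + 5)) ?c (peeled y)"
  proof (rule reaches_trans)
    fix d assume d: "based 40 d \<and> reg d 0 = n + ?a \<and> filled n (mem d)"
    then have "peeling y arc_set d" using y adm tabulated_filled by (simp add: peeling_def)
    then show "reaches program b (20 * card arc_set + 11 * n + 5) d (peeled y)"
      using peel d by blast
  qed
  then show ?thesis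
    by (rule reaches_trans_le[OF _ count]) (use a(3) dvd in auto)
qed

end

text \<open>In \<open>linear_time_computable\<close> one constant is both the factor of the time
  bound and the exponent of the word bound. The run needs at most 35 steps per vertex, 64 per edge
  and 57 more, so 100 is ample; for the words the exponent 2 would do.\<close>

lemma adjacency_lists_program:
  assumes F: "k_subdivision_graph k F" and k: "k = 4 * q + 3" and adj: "adjacency_lists F adj"
  shows "\<exists>t \<le> 100 * (graph_size F + 1).
      halted program (run program (encode adj) t) \<and>
      reg (run program (encode adj) t) 0 = super_domination_number F"
    and "words_le ((graph_size F + 2) ^ 100) (run program (encode adj) t)"
proof -
  interpret F: pair_graph F using F by (simp add: k_subdivision_graph_def)
  obtain vs where vs: "distinct vs" "set vs = pverts F" "length adj = length vs"
    and row: "\<And>i. i < length vs \<Longrightarrow> distinct (adj ! i) \<and>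
      set (adj ! i) = {j. j < length vs \<and> (vs ! i, vs ! j) \<in> parcs F}"
    using adj unfolding adjacency_lists_def by blast
  define n where "n = length adj"
  define A where "A = (SIGMA i:{..<n}. set (adj ! i))"
  \<comment> \<open>The square covers both growing demands of the locale: \<open>n * n\<close>, and
    the address range, which is at most \<open>4 * graph_size F + 4\<close>.\<close>
  define b where "b = (graph_size F + 2)\<^sup>2"
  have A: "(i, j) \<in> A \<longleftrightarrow> i < n \<and> j < n \<and> (vs ! i, vs ! j) \<in> parcs F" for i j
    using row vs(3) by (auto simp: A_def n_def)
  have Fsym: "sym (parcs F)" using F.pair_sym_arcs by (simp add: symmetric_def)
  have sym: "sym A" using Fsym by (auto simp: sym_def A)
  have irr: "irrefl A" using F.pair_no_loops by (force simp: irrefl_def A)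
  have inj: "inj_on ((!) vs) {..<n}" using vs by (auto simp: inj_on_def nth_eq_iff_index_eq n_def)
  have "A \<subseteq> {..<n} \<times> {..<n}" using A by auto
  then have fin: "finite A" and FA: "Field A \<subseteq> {..<n}"
    by (auto simp: Field_def intro: finite_subset)
  have parcs: "parcs F = map_prod ((!) vs) ((!) vs) ` A"
  proof (rule set_eqI)
    fix e
    show "e \<in> parcs F \<longleftrightarrow> e \<in> map_prod ((!) vs) ((!) vs) ` A"
    proof
      assume e: "e \<in> parcs F"
      then have "fst e \<in> set vs" "snd e \<in> set vs"
        using vs(2) F.arc_fst_in_verts F.arc_snd_in_verts by auto
      then obtain i j where "i < n" "j < n" "fst e = vs ! i" "snd e = vs ! j"
        using vs(3) by (auto simp: in_set_conv_nth n_def)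
      moreover from this have "e = (vs ! i, vs ! j)" by (simp add: prod_eq_iff)
      ultimately show "e \<in> map_prod ((!) vs) ((!) vs) ` A"
        using e A[of i j] by (intro image_eqI[of _ _ "(i, j)"]) auto
    next
      assume "e \<in> map_prod ((!) vs) ((!) vs) ` A"
      then show "e \<in> parcs F" using A by auto
    qed
  qed
  have "inj_on (map_prod ((!) vs) ((!) vs)) A"
    using map_prod_inj_on[OF inj inj] \<open>A \<subseteq> {..<n} \<times> {..<n}\<close> by (rule inj_on_subset)
  then have cardA: "card (parcs F) = card A" unfolding parcs by (rule card_image)
  have rank: "orient_rank (parcs F) = orient_rank A"
    unfolding parcs using fin inj_on_subset[OF inj FA] by (rule orient_rank_image)
  have cardV: "card (pverts F) = n" using vs distinct_card n_def by metis
  have gs: "graph_size F = n + card A div 2" by (simp add: graph_size_def cardV cardA)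
  have dvd: "4 dvd card A" and y: "super_domination_number F + orient_rank A = n + card A div 4"
    using super_domination_number_subdivision_graph[OF F k] by (simp_all add: cardA cardV rank)
  have L: "offset adj n = Suc (n + card A)"
    unfolding A_def n_def by (rule offset_length) (use row vs(3) in simp)
  define e where "e = card A div 2"
  have gs_e: "graph_size F = n + e" using gs by (simp add: e_def)
  have "card A mod 2 \<le> 1" by simp
  then have half: "card A \<le> 2 * e + 1"
    using div_mult_mod_eq[of "card A" 2] unfolding e_def by linarith
  have "adjacency_input adj b"
  proof
    have "offset adj n + 2 * n \<le> 4 * graph_size F + 4" using half by (simp add: L gs_e)
    also have "\<dots> \<le> b" by (simp add: b_def power2_eq_square algebra_simps)
    finally show "offset adj (length adj) + 2 * length adj \<le> b" by (simp add: n_def)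
    have "n * n \<le> graph_size F * graph_size F" unfolding gs_e by (intro mult_mono) auto
    also have "\<dots> \<le> b" by (simp add: b_def power2_eq_square algebra_simps)
    finally show "length adj * length adj \<le> b" by (simp add: n_def)
    show "4 \<le> b" by (simp add: b_def power2_eq_square algebra_simps)
  qed (use row vs(3) in auto)
  then interpret adjacency_input adj b n "offset adj n" "mem (init_config (encode adj))"
    by (simp_all add: n_def)
  have arc_set_A: "arc_set = A" by (simp add: arc_set_def A_def n_def)
  have "reaches program b (35 * n + 32 * card A + 25) (init_config (encode adj))
      (\<lambda>c. pc c = 76 \<and> reg c 0 = super_domination_number F)"
    using program_correct sym irr dvd y unfolding arc_set_A .
  then obtain t where t: "t \<le> 35 * n + 32 * card A + 25"
    "pc (run program (encode adj) t) = 76"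
    "reg (run program (encode adj) t) 0 = super_domination_number F"
    "\<And>s. s \<le> t \<Longrightarrow> words_le b (run program (encode adj) s)"
    unfolding reaches_def run_def by blast
  have halt: "halted program (run program (encode adj) t)"
    using t(2) by (simp add: halted_def length_program)
  moreover have "t \<le> 100 * (graph_size F + 1)"
    using t(1) half by (simp add: gs_e)
  ultimately show "\<exists>t \<le> 100 * (graph_size F + 1). halted program (run program (encode adj) t) \<and>
      reg (run program (encode adj) t) 0 = super_domination_number F"
    using t(3) by blast
  have "b \<le> (graph_size F + 2) ^ 100" unfolding b_def by (rule power_increasing) simp_all
  moreover have "words_le b (run program (encode adj) t')" for t'
    using words_le_after_halting[of program t "init_config (encode adj)" b] halt t(4)
    unfolding run_def by blast
  ultimately show "words_le ((graph_size F + 2) ^ 100) (run program (encode adj) t')" for t'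
    unfolding words_le_def by (meson le_trans)
qed

theorem theorem5p4:
  fixes k :: nat
  assumes "0 < k" and "[k = 3] (mod 4)"
  shows "linear_time_computable
           {F :: nat pair_pre_digraph. k_subdivision_graph k F} super_domination_number"
proof -
  have "k mod 4 = 3" using assms(2) by (simp add: cong_def)
  then have k: "k = 4 * (k div 4) + 3" using div_mult_mod_eq[of k 4] by simp
  show ?thesis
    unfolding linear_time_computable_def
    using adjacency_lists_program[OF _ k] by blast
qed

end
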